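(* Let $\Delta$ be a visibly BPA over actions $\mathit{Act}$ and stack alphabet $\Gamma$ such that every stack symbol of $\Gamma$ appears in at least one rule of $\Delta$. Then one can compute, in time $O(|\Delta|)$, a finite labelled transition system $T$ with $O(|\Delta|)$ states and $O(|\Delta|)$ transitions whose set of states contains $\Gamma$, such that for every $\bowtie\ \in\{\sqsubseteq_s,=_s,\sqsubseteq_{cs},=_{cs},\sqsubseteq_{rs},=_{rs},\sqsubseteq_{2s},=_{2s},\sim\}$ and all $X,Y\in\Gamma$: $X\bowtie Y$ in the transition system generated by $\Delta$ if and only if $X\bowtie Y$ in $T$. In particular, each of these preorder/equivalence checking problems on vBPA is reducible to checking the same preorder/equivalence on finite state systems.
   Context: A labelled transition system (LTS) is $(S,\mathit{Act},\to)$ with $\to\subseteq S\times\mathit{Act}\times S$; $I(s)=\{a\mid \exists s'.\,s\xrightarrow{a}s'\}$. A relation $R\subseteq S\times S$ is a simulation if for all $(s,t)\in R$ and $s\xrightarrow{a}s'$ there is $t\xrightarrow{a}t'$ with $(s',t')\in R$; a completed simulation if it is a simulation and for all $(s,t)\in R$, $I(s)=\emptyset$ iff $I(t)=\emptyset$; a ready simulation if it is a simulation with $I(s)=I(t)$ for all $(s,t)\in R$; a 2-nested simulation if it is a simulation and $R^{-1}\subseteq R'$ for some simulation $R'$; a bisimulation if it is a simulation and $R^{-1}=R$. The preorders $\sqsubseteq_s,\sqsubseteq_{cs},\sqsubseteq_{rs},\sqsubseteq_{2s}$ and $\sim$ relate $s,t$ iff some relation of the respective kind contains $(s,t)$; the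 equivalences $=_s,=_{cs},=_{rs},=_{2s}$ relate $s,t$ iff $s$ and $t$ are related by the corresponding preorder in both directions. A visibly BPA (vBPA) over actions $\mathit{Act}=\mathit{Act}_c\cup\mathit{Act}_r\cup\mathit{Act}_i$ (disjoint call, return, internal actions) and finite stack alphabet $\Gamma$ is a finite set $\Delta$ of rules $X\xrightarrow{a}\alpha$ ($X\in\Gamma$, $\alpha\in\Gamma^*$) with $|\alpha|=2$ if $a\in\mathit{Act}_c$, $|\alpha|=0$ if $a\in\mathit{Act}_r$, $|\alpha|=1$ if $a\in\mathit{Act}_i$; it generates the LTS on states $\Gamma^*$ with $X\gamma\xrightarrow{a}\alpha\gamma$ for every rule $X\xrightarrow{a}\alpha$ and $\gamma\in\Gamma^*$. $|\Delta|$ denotes the size of $\Delta$. *)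

theory Defs
  imports Complex_Main "HOL-Library.Landau_Symbols"
begin

section \<open>Labelled transition systems and behavioural relations\<close>

record ('s, 'a) lts =
  states :: "'s set"
  actions :: "'a set"
  transitions :: "('s \<times> 'a \<times> 's) set"

definition finite_lts :: "('s, 'a) lts \<Rightarrow> bool" where
  "finite_lts L \<longleftrightarrow> finite (states L) \<and> finite (actions L) \<and>
     transitions L \<subseteq> states L \<times> actions L \<times> states L"

definition initials :: "('s, 'a) lts \<Rightarrow> 's \<Rightarrow> 'a set" where
  "initials L s = {a. \<exists>s'. (s, a, s') \<in> transitions L}"

definition simulation :: "('s, 'a) lts \<Rightarrow> 's rel \<Rightarrow> bool" where
  "simulation L R \<longleftrightarrow> R \<subseteq> states L \<times> states L \<and>
     (\<forall>s t a s'. (s, t) \<in> R \<and> (s, a, s') \<in> transitions L \<longrightarrow>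
        (\<exists>t'. (t, a, t') \<in> transitions L \<and> (s', t') \<in> R))"

definition completed_simulation :: "('s, 'a) lts \<Rightarrow> 's rel \<Rightarrow> bool" where
  "completed_simulation L R \<longleftrightarrow> simulation L R \<and>
     (\<forall>(s, t) \<in> R. initials L s = {} \<longleftrightarrow> initials L t = {})"

definition ready_simulation :: "('s, 'a) lts \<Rightarrow> 's rel \<Rightarrow> bool" where
  "ready_simulation L R \<longleftrightarrow> simulation L R \<and>
     (\<forall>(s, t) \<in> R. initials L s = initials L t)"

definition two_nested_simulation :: "('s, 'a) lts \<Rightarrow> 's rel \<Rightarrow> bool" where
  "two_nested_simulation L R \<longleftrightarrow> simulation L R \<and>
     (\<exists>R'. simulation L R' \<and> R\<inverse> \<subseteq> R')"

definition bisimulation :: "('s, 'a) lts \<Rightarrow> 's rel \<Rightarrow> bool" where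
  "bisimulation L R \<longleftrightarrow> simulation L R \<and> R\<inverse> = R"

text \<open>The relations are named by a datatype because they have to be
  interpreted over systems with different state types.\<close>

datatype behavioural_relation =
    Sim_Preorder | Sim_Equiv
  | Completed_Sim_Preorder | Completed_Sim_Equiv
  | Ready_Sim_Preorder | Ready_Sim_Equiv
  | Two_Nested_Sim_Preorder | Two_Nested_Sim_Equiv
  | Bisimilarity

definition preorder_of ::
  "(('s, 'a) lts \<Rightarrow> 's rel \<Rightarrow> bool) \<Rightarrow> ('s, 'a) lts \<Rightarrow> 's \<Rightarrow> 's \<Rightarrow> bool" where
  "preorder_of K L s t \<longleftrightarrow> (\<exists>R. K L R \<and> (s, t) \<in> R)"

definition equivalence_of ::
  "(('s, 'a) lts \<Rightarrow> 's rel \<Rightarrow> bool) \<Rightarrow> ('s, 'a) lts \<Rightarrow> 's \<Rightarrow> 's \<Rightarrow> bool" where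
  "equivalence_of K L s t \<longleftrightarrow> preorder_of K L s t \<and> preorder_of K L t s"

fun related :: "behavioural_relation \<Rightarrow> ('s, 'a) lts \<Rightarrow> 's \<Rightarrow> 's \<Rightarrow> bool" where
  "related Sim_Preorder = preorder_of simulation"
| "related Sim_Equiv = equivalence_of simulation"
| "related Completed_Sim_Preorder = preorder_of completed_simulation"
| "related Completed_Sim_Equiv = equivalence_of completed_simulation"
| "related Ready_Sim_Preorder = preorder_of ready_simulation"
| "related Ready_Sim_Equiv = equivalence_of ready_simulation"
| "related Two_Nested_Sim_Preorder = preorder_of two_nested_simulation"
| "related Two_Nested_Sim_Equiv = equivalence_of two_nested_simulation"
| "related Bisimilarity = preorder_of bisimulation"


section \<open>Visibly BPA\<close>

type_synonym ('g, 'a) rule = "'g \<times> 'a \<times> 'g list"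

definition vbpa ::
  "'a set \<Rightarrow> 'a set \<Rightarrow> 'a set \<Rightarrow> 'g set \<Rightarrow> ('g, 'a) rule set \<Rightarrow> bool" where
  "vbpa Act\<^sub>c Act\<^sub>r Act\<^sub>i \<Gamma> \<Delta> \<longleftrightarrow>
     Act\<^sub>c \<inter> Act\<^sub>r = {} \<and> Act\<^sub>c \<inter> Act\<^sub>i = {} \<and> Act\<^sub>r \<inter> Act\<^sub>i = {} \<and>
     finite \<Gamma> \<and> finite \<Delta> \<and>
     (\<forall>(X, a, \<alpha>) \<in> \<Delta>. X \<in> \<Gamma> \<and> a \<in> Act\<^sub>c \<union> Act\<^sub>r \<union> Act\<^sub>i \<and> set \<alpha> \<subseteq> \<Gamma> \<and>
        (a \<in> Act\<^sub>c \<longrightarrow> length \<alpha> = 2) \<and>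
        (a \<in> Act\<^sub>r \<longrightarrow> length \<alpha> = 0) \<and>
        (a \<in> Act\<^sub>i \<longrightarrow> length \<alpha> = 1))"

definition vbpa_lts ::
  "'a set \<Rightarrow> 'a set \<Rightarrow> 'a set \<Rightarrow> 'g set \<Rightarrow> ('g, 'a) rule set \<Rightarrow> ('g list, 'a) lts" where
  "vbpa_lts Act\<^sub>c Act\<^sub>r Act\<^sub>i \<Gamma> \<Delta> =
     \<lparr> states = lists \<Gamma>,
       actions = Act\<^sub>c \<union> Act\<^sub>r \<union> Act\<^sub>i,
       transitions = {(X # \<gamma>, a, \<alpha> @ \<gamma>) | X a \<alpha> \<gamma>. (X, a, \<alpha>) \<in> \<Delta> \<and> \<gamma> \<in> lists \<Gamma>} \<rparr>"

definition all_symbols_used :: "'g set \<Rightarrow> ('g, 'a) rule set \<Rightarrow> bool" where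
  "all_symbols_used \<Gamma> \<Delta> \<longleftrightarrow> (\<forall>Z \<in> \<Gamma>. \<exists>(X, a, \<alpha>) \<in> \<Delta>. Z = X \<or> Z \<in> set \<alpha>)"

text \<open>The size of a set of rules is the number of symbols needed to write it
  down. In a visibly BPA every rule contributes between 2 and 4, so this
  agrees with the number of rules up to a constant factor.\<close>

definition rules_size :: "('g, 'a) rule set \<Rightarrow> nat" where
  "rules_size \<Delta> = (\<Sum>(X, a, \<alpha>) \<in> \<Delta>. 2 + length \<alpha>)"


section \<open>Random access machines\<close>

text \<open>
  Running times are measured on the unit-cost random access machine of Cook
  and Reckhow (constants, addition, subtraction, indirect load and store,
  reading and printing of one number), here over the natural numbers, with
  truncated subtraction, and with structured control flow instead of jumps.
  An address \<open>i\<close> in an instruction denotes the memory cell (register) \<open>i\<close>.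
  The program is fixed once and for all, and there is no multiplication.
\<close>

datatype ram =
    Const nat nat
  | Add nat nat nat
  | Sub nat nat nat
  | Load nat nat
  | Store nat nat
  | Read nat
  | Print nat
  | Seq ram ram
  | Cond nat ram ram
  | Loop nat ram

text \<open>Memory, remaining input, output printed so far.\<close>

type_synonym ram_config = "(nat \<Rightarrow> nat) \<times> nat list \<times> nat list"

inductive exec :: "ram \<Rightarrow> ram_config \<Rightarrow> nat \<Rightarrow> ram_config \<Rightarrow> bool" where
  Const: "exec (Const i n) (m, u, v) 1 (m(i := n), u, v)"
| Add: "exec (Add i j k) (m, u, v) 1 (m(i := m j + m k), u, v)"
| Sub: "exec (Sub i j k) (m, u, v) 1 (m(i := m j - m k), u, v)"
| Load: "exec (Load i j) (m, u, v) 1 (m(i := m (m j)), u, v)"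
| Store: "exec (Store i j) (m, u, v) 1 (m(m i := m j), u, v)"
| Read: "exec (Read i) (m, x # u, v) 1 (m(i := x), u, v)"
| Print: "exec (Print i) (m, u, v) 1 (m, u, v @ [m i])"
| Seq: "exec p c n c' \<Longrightarrow> exec q c' n' c'' \<Longrightarrow> exec (Seq p q) c (n + n') c''"
| Cond_True: "m i \<noteq> 0 \<Longrightarrow> exec p (m, u, v) n c \<Longrightarrow> exec (Cond i p q) (m, u, v) (1 + n) c"
| Cond_False: "m i = 0 \<Longrightarrow> exec q (m, u, v) n c \<Longrightarrow> exec (Cond i p q) (m, u, v) (1 + n) c"
| Loop_False: "m i = 0 \<Longrightarrow> exec (Loop i p) (m, u, v) 1 (m, u, v)"
| Loop_True: "m i \<noteq> 0 \<Longrightarrow> exec p (m, u, v) n c \<Longrightarrow> exec (Loop i p) c n' c' \<Longrightarrow>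
    exec (Loop i p) (m, u, v) (1 + n + n') c'"

definition outputs_in :: "ram \<Rightarrow> nat list \<Rightarrow> nat list \<Rightarrow> nat \<Rightarrow> bool" where
  "outputs_in p u v n \<longleftrightarrow> (\<exists>m u'. exec p (\<lambda>_. 0, u, []) n (m, u', v))"

definition linearly_bounded :: "(nat \<Rightarrow> nat) \<Rightarrow> bool" where
  "linearly_bounded f \<longleftrightarrow> (\<lambda>n. real (f n)) \<in> O(\<lambda>n. real n)"


section \<open>Encodings\<close>

definition enumerates :: "'b list \<Rightarrow> 'b set \<Rightarrow> bool" where
  "enumerates xs A \<longleftrightarrow> distinct xs \<and> set xs = A"

definition encode_list :: "('b \<Rightarrow> nat list) \<Rightarrow> 'b list \<Rightarrow> nat list" where
  "encode_list f xs = length xs # concat (map f xs)"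

text \<open>The partition of the actions is not part of the encoding: the class of
  an action that occurs in a rule is determined by the length of the
  right-hand side, and the remaining actions (there may be infinitely many)
  are irrelevant.\<close>

definition encodes_vbpa :: "nat list \<Rightarrow> nat set \<Rightarrow> (nat, nat) rule set \<Rightarrow> bool" where
  "encodes_vbpa w \<Gamma> \<Delta> \<longleftrightarrow>
     (\<exists>gs rs. enumerates gs \<Gamma> \<and> enumerates rs \<Delta> \<and>
        w = encode_list (\<lambda>X. [X]) gs @
            encode_list (\<lambda>(X, a, \<alpha>). [X, a] @ encode_list (\<lambda>Y. [Y]) \<alpha>) rs)"

definition encodes_lts :: "nat list \<Rightarrow> (nat, nat) lts \<Rightarrow> bool" where
  "encodes_lts w T \<longleftrightarrow>
     (\<exists>ss as ts. enumerates ss (states T) \<and> enumerates as (actions T) \<and>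
        enumerates ts (transitions T) \<and>
        w = encode_list (\<lambda>s. [s]) ss @ encode_list (\<lambda>a. [a]) as @
            encode_list (\<lambda>(s, a, s'). [s, a, s']) ts)"


section \<open>Decision problems and reductions\<close>

text \<open>A decision problem is given by its positive and its negative instances;
  words that encode no instance belong to neither set.\<close>

type_synonym problem = "nat list set \<times> nat list set"

definition vbpa_problem :: "behavioural_relation \<Rightarrow> problem" where
  "vbpa_problem b =
    ({w @ [X, Y] | w X Y. \<exists>Act\<^sub>c Act\<^sub>r Act\<^sub>i \<Gamma> \<Delta>. vbpa Act\<^sub>c Act\<^sub>r Act\<^sub>i \<Gamma> \<Delta> \<and>
        encodes_vbpa w \<Gamma> \<Delta> \<and> X \<in> \<Gamma> \<and> Y \<in> \<Gamma> \<and>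
        related b (vbpa_lts Act\<^sub>c Act\<^sub>r Act\<^sub>i \<Gamma> \<Delta>) [X] [Y]},
     {w @ [X, Y] | w X Y. \<exists>Act\<^sub>c Act\<^sub>r Act\<^sub>i \<Gamma> \<Delta>. vbpa Act\<^sub>c Act\<^sub>r Act\<^sub>i \<Gamma> \<Delta> \<and>
        encodes_vbpa w \<Gamma> \<Delta> \<and> X \<in> \<Gamma> \<and> Y \<in> \<Gamma> \<and>
        \<not> related b (vbpa_lts Act\<^sub>c Act\<^sub>r Act\<^sub>i \<Gamma> \<Delta>) [X] [Y]})"

definition finite_state_problem :: "behavioural_relation \<Rightarrow> problem" where
  "finite_state_problem b =
    ({w @ [s, t] | w s t. \<exists>T. finite_lts T \<and> encodes_lts w T \<and>
        s \<in> states T \<and> t \<in> states T \<and> related b T s t},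
     {w @ [s, t] | w s t. \<exists>T. finite_lts T \<and> encodes_lts w T \<and>
        s \<in> states T \<and> t \<in> states T \<and> \<not> related b T s t})"

definition linear_time_reducible :: "problem \<Rightarrow> problem \<Rightarrow> bool" where
  "linear_time_reducible A B \<longleftrightarrow>
     (\<exists>p f. linearly_bounded f \<and>
        (\<forall>w \<in> fst A \<union> snd A. \<exists>v n. outputs_in p w v n \<and> n \<le> f (length w) \<and>
           (w \<in> fst A \<longrightarrow> v \<in> fst B) \<and> (w \<in> snd A \<longrightarrow> v \<in> snd B)))"

end

theory Submission
  imports Defs
begin

text \<open>
  Along related states the stacks have equal height, because an action determines how the height
  changes. Hence \<open>YZ\<close> is related to \<open>Y'Z'\<close> iff \<open>Y\<close> is related to \<open>Y'\<close> and, in case \<open>Y\<close> can be popped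
  at all (\<open>Y\<close> is normed), \<open>Z\<close> is related to \<open>Z'\<close>. The finite system therefore replaces the target of
  a rule by a state that has an \<open>l\<^sub>0\<close>-transition to the first symbol and, if that symbol is normed, an
  \<open>l\<^sub>1\<close>-transition to the second one. A normed symbol is only ever related to a normed one, but not
  conversely. An additional \<open>l\<^sub>1\<close>-transition to a sink with a label of its own keeps the sets of initial
  actions equal, as ready simulation requires.

  The normed symbols are the only part that is not read off the rules directly. They are marked in
  linear time by letting every rule wait for one unmarked symbol of its right-hand side.
\<close>

section \<open>The finite system\<close>

text \<open>The obstacle is asymmetry. A symbol that is not normed may lie below a normed one, so
  the second target can be missing on the simulated side while it is present on the other; hence
  every intermediate state may retreat to the sink \<open>F\<close>. The retreat must not hide a
  real difference. The sinks loop under \<open>l\<^sub>2\<close>, a label of no rule, so a symbol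
  below a sink is deadlocked. If the sinks were deadlocked as well, completed and ready simulation
  could match a deadlocked second symbol with \<open>F\<close> although the other second symbol is
  live.

  Having two sinks \<open>E\<close> and \<open>F\<close> keeps the four transitions of a rule
  distinct, so they are printed without a search for duplicates. Renaming actions to rule numbers
  serves the same end: the label set is an interval and no list of the occurring actions has to be
  compiled.

  Normedness is a least fixed point of Horn rules with at most two symbols in the body. This is why
  the waiting lists known from linear-time unit propagation apply.\<close>

inductive_set normed :: "('g, 'a) rule set \<Rightarrow> 'g set" for \<Delta> where
  "(X, a, \<alpha>) \<in> \<Delta> \<Longrightarrow> (\<And>Y. Y \<in> set \<alpha> \<Longrightarrow> Y \<in> normed \<Delta>) \<Longrightarrow> X \<in> normed \<Delta>"

text \<open>The construction does not depend on how fresh states and labels are numbered.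
  \<open>f\<close> is injective on the actions of rules only, since there may be infinitely many
  others, and \<open>A\<close> just has to cover the labels that occur.\<close>

locale finite_state_reduction =
  fixes Act\<^sub>c Act\<^sub>r Act\<^sub>i :: "'a set" and \<Gamma> :: "'g set" and \<Delta> :: "('g, 'a) rule set"
    and E F :: 'g and st :: "('g, 'a) rule \<Rightarrow> 'g"
    and f :: "'a \<Rightarrow> 'b" and l\<^sub>0 l\<^sub>1 l\<^sub>2 :: 'b and A :: "'b set"
  assumes vbpa: "vbpa Act\<^sub>c Act\<^sub>r Act\<^sub>i \<Gamma> \<Delta>"
    and E_notin: "E \<notin> \<Gamma>" and F_notin: "F \<notin> \<Gamma>" and E_neq_F: "E \<noteq> F"
    and inj_st: "inj_on st \<Delta>"
    and st_fresh: "r \<in> \<Delta> \<Longrightarrow> st r \<notin> \<Gamma>" "r \<in> \<Delta> \<Longrightarrow> st r \<noteq> E" "r \<in> \<Delta> \<Longrightarrow> st r \<noteq> F"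
    and f_inj: "(X, a, \<alpha>) \<in> \<Delta> \<Longrightarrow> (Y, b, \<beta>) \<in> \<Delta> \<Longrightarrow> f a = f b \<Longrightarrow> a = b"
    and f_fresh: "(X, a, \<alpha>) \<in> \<Delta> \<Longrightarrow> f a \<notin> {l\<^sub>0, l\<^sub>1, l\<^sub>2}"
    and labels_distinct: "distinct [l\<^sub>0, l\<^sub>1, l\<^sub>2]"
    and finite_A: "finite A"
    and labels_in: "{l\<^sub>0, l\<^sub>1, l\<^sub>2} \<subseteq> A" "(X, a, \<alpha>) \<in> \<Delta> \<Longrightarrow> f a \<in> A"
begin

abbreviation P :: "('g list, 'a) lts" where
  "P \<equiv> vbpa_lts Act\<^sub>c Act\<^sub>r Act\<^sub>i \<Gamma> \<Delta>"

definition left :: "'g list \<Rightarrow> 'g" where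
  "left \<alpha> = (if \<alpha> = [] then E else hd \<alpha>)"

definition right :: "'g list \<Rightarrow> 'g" where
  "right \<alpha> = (if length \<alpha> = 2 \<and> hd \<alpha> \<in> normed \<Delta> then \<alpha> ! 1 else E)"

definition T :: "('g, 'b) lts" where
  "T = \<lparr> states = \<Gamma> \<union> {E, F} \<union> st ` \<Delta>, actions = A,
     transitions = {(E, l\<^sub>2, F), (F, l\<^sub>2, F)} \<union>
       (\<Union>(X, a, \<alpha>) \<in> \<Delta>. {(X, f a, st (X, a, \<alpha>)), (st (X, a, \<alpha>), l\<^sub>0, left \<alpha>),
          (st (X, a, \<alpha>), l\<^sub>1, right \<alpha>), (st (X, a, \<alpha>), l\<^sub>1, F)}) \<rparr>"

lemma rule_shape:
  assumes "(X, a, \<alpha>) \<in> \<Delta>"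
  shows "X \<in> \<Gamma> \<and> set \<alpha> \<subseteq> \<Gamma> \<and> a \<in> Act\<^sub>c \<union> Act\<^sub>r \<union> Act\<^sub>i \<and> (a \<in> Act\<^sub>c \<longrightarrow> length \<alpha> = 2) \<and>
    (a \<in> Act\<^sub>r \<longrightarrow> length \<alpha> = 0) \<and> (a \<in> Act\<^sub>i \<longrightarrow> length \<alpha> = 1)"
  using vbpa assms unfolding vbpa_def by (elim conjE) (drule (1) bspec, simp)

lemma rule_symbols:
  assumes "(X, a, \<alpha>) \<in> \<Delta>"
  shows "X \<in> \<Gamma>" "set \<alpha> \<subseteq> \<Gamma>" "length \<alpha> \<le> 2"
  using rule_shape[OF assms] by auto

lemma rule_length:
  assumes "(X, a, \<alpha>) \<in> \<Delta>" "(Y, a, \<beta>) \<in> \<Delta>"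
  shows "length \<alpha> = length \<beta>"
  using rule_shape[OF assms(1)] rule_shape[OF assms(2)] by auto

lemma left_in: "(X, a, \<alpha>) \<in> \<Delta> \<Longrightarrow> left \<alpha> \<in> insert E \<Gamma>"
  using rule_symbols(2)[of X a \<alpha>] by (cases \<alpha>) (auto simp: left_def)

lemma right_in: "(X, a, \<alpha>) \<in> \<Delta> \<Longrightarrow> right \<alpha> \<in> insert E \<Gamma>"
  using rule_symbols(2)[of X a \<alpha>] by (auto simp: right_def subset_iff)

lemma finite_lts_T: "finite_lts T"
proof -
  have "transitions T \<subseteq> states T \<times> actions T \<times> states T"
    using labels_in by (auto simp: T_def dest: left_in right_in rule_symbols(1))
  moreover have "finite \<Gamma>" "finite \<Delta>"
    using vbpa by (simp_all add: vbpa_def)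
  ultimately show ?thesis
    using finite_A by (simp add: finite_lts_def T_def)
qed

lemma P_states: "states P = lists \<Gamma>"
  by (simp add: vbpa_lts_def)

lemma P_Nil: "([], a, \<gamma>) \<notin> transitions P"
  by (simp add: vbpa_lts_def)

lemma P_Cons: "(X # \<gamma>, a, \<delta>) \<in> transitions P \<longleftrightarrow>
    \<gamma> \<in> lists \<Gamma> \<and> (\<exists>\<alpha>. (X, a, \<alpha>) \<in> \<Delta> \<and> \<delta> = \<alpha> @ \<gamma>)"
  by (auto simp: vbpa_lts_def)

lemma T_states: "states T = \<Gamma> \<union> {E, F} \<union> st ` \<Delta>"
  by (simp add: T_def)

lemma T_symbol: "X \<in> \<Gamma> \<Longrightarrow> (X, b, s) \<in> transitions T \<longleftrightarrow>
    (\<exists>a \<alpha>. (X, a, \<alpha>) \<in> \<Delta> \<and> b = f a \<and> s = st (X, a, \<alpha>))"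
  using E_notin F_notin by (auto simp: T_def dest: st_fresh(1))

lemma T_sink: "s \<in> {E, F} \<Longrightarrow> (s, b, s') \<in> transitions T \<longleftrightarrow> b = l\<^sub>2 \<and> s' = F"
  using E_notin F_notin by (auto simp: T_def dest: st_fresh(2,3) rule_symbols(1))

lemma T_st:
  assumes r: "(X, a, \<alpha>) \<in> \<Delta>"
  shows "(st (X, a, \<alpha>), b, s) \<in> transitions T \<longleftrightarrow>
    b = l\<^sub>0 \<and> s = left \<alpha> \<or> b = l\<^sub>1 \<and> (s = right \<alpha> \<or> s = F)" (is "?L \<longleftrightarrow> ?R")
proof
  assume ?L
  then consider "st (X, a, \<alpha>) \<in> {E, F}"
    | X' a' \<alpha>' where "(X', a', \<alpha>') \<in> \<Delta>" "st (X, a, \<alpha>) = X'"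
    | X' a' \<alpha>' where "(X', a', \<alpha>') \<in> \<Delta>" "st (X, a, \<alpha>) = st (X', a', \<alpha>')"
        "b = l\<^sub>0 \<and> s = left \<alpha>' \<or> b = l\<^sub>1 \<and> (s = right \<alpha>' \<or> s = F)"
    unfolding T_def by auto
  then show ?R
  proof cases
    case 3
    then show ?thesis using inj_onD[OF inj_st _ r] by blast
  qed (use r st_fresh rule_symbols(1) in blast)+
qed (use r in \<open>auto simp: T_def\<close>)

lemma initials_P_Cons: "\<gamma> \<in> lists \<Gamma> \<Longrightarrow> initials P (X # \<gamma>) = {a. \<exists>\<alpha>. (X, a, \<alpha>) \<in> \<Delta>}"
  by (auto simp: initials_def P_Cons)

lemma initials_T_symbol: "X \<in> \<Gamma> \<Longrightarrow> initials T X = f ` {a. \<exists>\<alpha>. (X, a, \<alpha>) \<in> \<Delta>}"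
  by (auto simp: initials_def T_symbol)

lemma initials_T_st: "r \<in> \<Delta> \<Longrightarrow> initials T (st r) = {l\<^sub>0, l\<^sub>1}"
  by (cases r) (auto simp: initials_def T_st)

lemma initials_T_sink: "s \<in> {E, F} \<Longrightarrow> initials T s = {l\<^sub>2}"
  by (simp add: initials_def T_sink)

lemma initials_T_eq_iff:
  assumes "X \<in> \<Gamma>" "Y \<in> \<Gamma>" "\<gamma> \<in> lists \<Gamma>" "\<delta> \<in> lists \<Gamma>"
  shows "initials T X = initials T Y \<longleftrightarrow> initials P (X # \<gamma>) = initials P (Y # \<delta>)"
proof -
  have "inj_on f {a. \<exists>X \<alpha>. (X, a, \<alpha>) \<in> \<Delta>}"
    using f_inj by (fastforce intro: inj_onI)
  then have "f ` {a. \<exists>\<alpha>. (X, a, \<alpha>) \<in> \<Delta>} = f ` {a. \<exists>\<alpha>. (Y, a, \<alpha>) \<in> \<Delta>} \<longleftrightarrow>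
      {a. \<exists>\<alpha>. (X, a, \<alpha>) \<in> \<Delta>} = {a. \<exists>\<alpha>. (Y, a, \<alpha>) \<in> \<Delta>}"
    by (rule inj_on_image_eq_iff) auto
  then show ?thesis
    using assms by (simp only: initials_T_symbol initials_P_Cons)
qed

text \<open>Because the height of the stack is determined by the actions, a simulation of a popping
  run pops as well.\<close>

lemma simulation_P_pop:
  assumes sim: "simulation P R" and "X \<in> normed \<Delta>"
    and "(X # \<gamma>, Y # \<delta>) \<in> R" "length \<gamma> = length \<delta>"
  shows "Y \<in> normed \<Delta> \<and> (\<gamma>, \<delta>) \<in> R"
  using assms(2-4)
proof (induction X arbitrary: Y \<gamma> \<delta> rule: normed.induct)
  case (1 X a \<alpha>)
  have "X # \<gamma> \<in> lists \<Gamma>"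
    using sim "1.prems"(1) P_states by (auto simp: simulation_def)
  then have "(X # \<gamma>, a, \<alpha> @ \<gamma>) \<in> transitions P"
    using "1.hyps"(1) by (auto simp: P_Cons)
  then obtain \<zeta> where "(Y # \<delta>, a, \<zeta>) \<in> transitions P" "(\<alpha> @ \<gamma>, \<zeta>) \<in> R"
    using sim "1.prems"(1) unfolding simulation_def by blast
  then obtain \<beta> where \<beta>: "(Y, a, \<beta>) \<in> \<Delta>" "(\<alpha> @ \<gamma>, \<beta> @ \<delta>) \<in> R"
    by (auto simp: P_Cons)
  have "length \<alpha> = length \<beta>"
    using rule_length "1.hyps"(1) \<beta>(1) by blast
  \<comment> \<open>The symbols of \<open>\<alpha>\<close> are popped one after the other, each by
    its own hypothesis of the outer induction; the rests keep equal heights throughout.\<close>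
  then have "set \<beta> \<subseteq> normed \<Delta> \<and> (\<gamma>, \<delta>) \<in> R"
    using \<beta>(2) "1.IH"
  proof (induction \<alpha> \<beta> rule: list_induct2)
    case (Cons Z \<alpha> Z' \<beta>)
    have "Z' \<in> normed \<Delta> \<and> (\<alpha> @ \<gamma>, \<beta> @ \<delta>) \<in> R"
      using Cons.prems(2)[of Z "\<alpha> @ \<gamma>" Z' "\<beta> @ \<delta>"] Cons.prems(1) Cons.hyps "1.prems"(2) by simp
    moreover have "set \<beta> \<subseteq> normed \<Delta> \<and> (\<gamma>, \<delta>) \<in> R"
      by (rule Cons.IH[OF conjunct2[OF calculation] Cons.prems(2)]) simp_all
    ultimately show ?case by simp
  qed simp
  then show ?case
    using normed.intros[OF \<beta>(1)] by blast
qed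

section \<open>Lifting simulations between stacks to the finite system\<close>

text \<open>A state of \<open>T\<close> shows only the top of a stack, so the rests
  \<open>\<gamma>\<close> and \<open>\<delta>\<close> are quantified away. Their equal height is
  kept, because \<open>simulation_P_pop\<close> needs it to expose the symbols underneath.\<close>

definition lift :: "'g list rel \<Rightarrow> 'g rel" where
  "lift R = {E, F} \<times> {E, F} \<union>
     {(X, Y). \<exists>\<gamma> \<delta>. length \<gamma> = length \<delta> \<and> (X # \<gamma>, Y # \<delta>) \<in> R} \<union>
     {(st (X, a, \<alpha>), st (Y, b, \<beta>)) | X a \<alpha> Y b \<beta>. (X, a, \<alpha>) \<in> \<Delta> \<and> (Y, b, \<beta>) \<in> \<Delta> \<and>
        length \<alpha> = length \<beta> \<and> (\<exists>\<gamma> \<delta>. length \<gamma> = length \<delta> \<and> (\<alpha> @ \<gamma>, \<beta> @ \<delta>) \<in> R)}"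

lemma lift_cases:
  assumes "simulation P R" "(s, t) \<in> lift R"
  obtains "s \<in> {E, F}" "t \<in> {E, F}"
  | \<gamma> \<delta> where "s \<in> \<Gamma>" "t \<in> \<Gamma>" "\<gamma> \<in> lists \<Gamma>" "\<delta> \<in> lists \<Gamma>" "length \<gamma> = length \<delta>"
      "(s # \<gamma>, t # \<delta>) \<in> R"
  | X a \<alpha> Y b \<beta> \<gamma> \<delta> where "s = st (X, a, \<alpha>)" "t = st (Y, b, \<beta>)" "(X, a, \<alpha>) \<in> \<Delta>" "(Y, b, \<beta>) \<in> \<Delta>"
      "length \<alpha> = length \<beta>" "length \<gamma> = length \<delta>" "(\<alpha> @ \<gamma>, \<beta> @ \<delta>) \<in> R"
proof -
  have sub: "R \<subseteq> lists \<Gamma> \<times> lists \<Gamma>"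
    using assms(1) P_states by (auto simp: simulation_def)
  consider "s \<in> {E, F}" "t \<in> {E, F}"
    | \<gamma> \<delta> where "length \<gamma> = length \<delta>" "(s # \<gamma>, t # \<delta>) \<in> R"
    | X a \<alpha> Y b \<beta> \<gamma> \<delta> where "s = st (X, a, \<alpha>)" "t = st (Y, b, \<beta>)" "(X, a, \<alpha>) \<in> \<Delta>" "(Y, b, \<beta>) \<in> \<Delta>"
      "length \<alpha> = length \<beta>" "length \<gamma> = length \<delta>" "(\<alpha> @ \<gamma>, \<beta> @ \<delta>) \<in> R"
    using assms(2) unfolding lift_def by blast
  then show thesis
  proof cases
    case 1
    then show ?thesis by (rule that(1))
  next
    case (2 \<gamma> \<delta>)
    then have "s # \<gamma> \<in> lists \<Gamma>" "t # \<delta> \<in> lists \<Gamma>"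
      using sub by blast+
    with 2 show ?thesis using that(2)[of \<gamma> \<delta>] by simp
  next
    case 3
    then show ?thesis by (rule that(3))
  qed
qed

lemma lift_sink: "s \<in> {E, F} \<Longrightarrow> t \<in> {E, F} \<Longrightarrow> (s, t) \<in> lift R"
  by (auto simp: lift_def)

lemma lift_symbol: "length \<gamma> = length \<delta> \<Longrightarrow> (X # \<gamma>, Y # \<delta>) \<in> R \<Longrightarrow> (X, Y) \<in> lift R"
  by (auto simp: lift_def)

lemma lift_st:
  "(X, a, \<alpha>) \<in> \<Delta> \<Longrightarrow> (Y, b, \<beta>) \<in> \<Delta> \<Longrightarrow> length \<alpha> = length \<beta> \<Longrightarrow> length \<gamma> = length \<delta> \<Longrightarrow>
    (\<alpha> @ \<gamma>, \<beta> @ \<delta>) \<in> R \<Longrightarrow> (st (X, a, \<alpha>), st (Y, b, \<beta>)) \<in> lift R"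
  unfolding lift_def by blast

lemma lift_mono: "R \<subseteq> R' \<Longrightarrow> lift R \<subseteq> lift R'"
  unfolding lift_def by blast

lemma lift_converse: "(lift R)\<inverse> = lift (R\<inverse>)"
proof -
  have "(lift R)\<inverse> \<subseteq> lift (R\<inverse>)" for R
  proof (rule subrelI)
    fix t s assume "(t, s) \<in> (lift R)\<inverse>"
    then consider "s \<in> {E, F}" "t \<in> {E, F}"
      | \<gamma> \<delta> where "length \<delta> = length \<gamma>" "(t # \<delta>, s # \<gamma>) \<in> R\<inverse>"
      | X a \<alpha> Y b \<beta> \<gamma> \<delta> where "s = st (X, a, \<alpha>)" "t = st (Y, b, \<beta>)" "(X, a, \<alpha>) \<in> \<Delta>"
        "(Y, b, \<beta>) \<in> \<Delta>" "length \<beta> = length \<alpha>" "length \<delta> = length \<gamma>" "(\<beta> @ \<delta>, \<alpha> @ \<gamma>) \<in> R\<inverse>"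
      unfolding lift_def by fastforce
    then show "(t, s) \<in> lift (R\<inverse>)"
      by cases (auto intro: lift_sink lift_symbol lift_st)
  qed
  from this[of R] this[of "R\<inverse>"] show ?thesis
    by auto
qed

text \<open>If the first of two symbols in \<open>\<alpha>\<close> is normed, popping it exposes the
  second symbols as a related pair, and the first symbol of \<open>\<beta>\<close> is normed too.
  Otherwise \<open>right \<alpha>\<close> is \<open>E\<close>, and nothing can be promised about
  \<open>right \<beta>\<close>: the first symbol of \<open>\<beta>\<close> may be normed.\<close>

lemma lift_step_right:
  assumes sim: "simulation P R" and r: "(X, a, \<alpha>) \<in> \<Delta>" "(Y, b, \<beta>) \<in> \<Delta>"
    and len: "length \<alpha> = length \<beta>" "length \<gamma> = length \<delta>" and R: "(\<alpha> @ \<gamma>, \<beta> @ \<delta>) \<in> R"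
  shows "(right \<alpha>, right \<beta>) \<in> lift R \<or> right \<alpha> = E"
proof (cases "length \<alpha> = 2 \<and> hd \<alpha> \<in> normed \<Delta>")
  case True
  then obtain U V U' V' where \<alpha>\<beta>: "\<alpha> = [U, V]" "\<beta> = [U', V']"
    using len(1) by (auto simp: length_Suc_conv numeral_2_eq_2)
  have "U' \<in> normed \<Delta> \<and> (V # \<gamma>, V' # \<delta>) \<in> R"
    using simulation_P_pop[OF sim, of U "V # \<gamma>" U' "V' # \<delta>"] True R len(2) by (simp add: \<alpha>\<beta>)
  then show ?thesis
    using True lift_symbol[OF len(2)] by (auto simp: right_def \<alpha>\<beta>)
qed (auto simp: right_def)

lemma lift_step_left:
  assumes len: "length \<alpha> = length \<beta>" "length \<gamma> = length \<delta>" and R: "(\<alpha> @ \<gamma>, \<beta> @ \<delta>) \<in> R"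
  shows "(left \<alpha>, left \<beta>) \<in> lift R"
proof (cases "\<alpha> = []")
  case True
  then show ?thesis using len(1) lift_sink by (simp add: left_def)
next
  case False
  then obtain U \<alpha>' U' \<beta>' where "\<alpha> = U # \<alpha>'" "\<beta> = U' # \<beta>'"
    using len(1) by (metis length_0_conv neq_Nil_conv)
  then show ?thesis
    using lift_symbol[of "\<alpha>' @ \<gamma>" "\<beta>' @ \<delta>" U U' R] len R by (simp add: left_def)
qed

lemma simulation_lift:
  assumes sim: "simulation P R"
  shows "simulation T (lift R)"
  unfolding simulation_def
proof (intro conjI allI impI)
  show "lift R \<subseteq> states T \<times> states T"
  proof (rule subrelI)
    fix s t assume "(s, t) \<in> lift R"
    with sim show "(s, t) \<in> states T \<times> states T"
      by (cases rule: lift_cases) (auto simp: T_states)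
  qed
next
  fix s t b s'
  assume *: "(s, t) \<in> lift R \<and> (s, b, s') \<in> transitions T"
  from sim conjunct1[OF *] show "\<exists>t'. (t, b, t') \<in> transitions T \<and> (s', t') \<in> lift R"
  proof (cases rule: lift_cases)
    case 1
    then have "b = l\<^sub>2 \<and> s' = F" "(t, l\<^sub>2, F) \<in> transitions T"
      using * T_sink[of s] T_sink[of t] by simp_all
    then show ?thesis using lift_sink[of F F] by auto
  next
    case (2 \<gamma> \<delta>)
    then obtain a \<alpha> where \<alpha>: "(s, a, \<alpha>) \<in> \<Delta>" "b = f a" "s' = st (s, a, \<alpha>)"
      using * T_symbol[OF 2(1)] by auto
    have "(s # \<gamma>, a, \<alpha> @ \<gamma>) \<in> transitions P"
      using \<alpha> 2 by (auto simp: P_Cons)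
    then obtain \<zeta> where "(t # \<delta>, a, \<zeta>) \<in> transitions P" "(\<alpha> @ \<gamma>, \<zeta>) \<in> R"
      using sim 2(6) unfolding simulation_def by blast
    then obtain \<beta> where \<beta>: "(t, a, \<beta>) \<in> \<Delta>" "(\<alpha> @ \<gamma>, \<beta> @ \<delta>) \<in> R"
      by (auto simp: P_Cons)
    then show ?thesis
      using lift_st[OF \<alpha>(1) \<beta>(1) rule_length[OF \<alpha>(1) \<beta>(1)] 2(5)] T_symbol[OF 2(2)] \<alpha>(2,3) by auto
  next
    case (3 X a \<alpha> Y c \<beta> \<gamma> \<delta>)
    have t: "(t, l\<^sub>0, left \<beta>) \<in> transitions T" "(t, l\<^sub>1, right \<beta>) \<in> transitions T"
      "(t, l\<^sub>1, F) \<in> transitions T"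
      using 3(2) T_st[OF 3(4)] by simp_all
    have "b = l\<^sub>0 \<and> s' = left \<alpha> \<or> b = l\<^sub>1 \<and> (s' = right \<alpha> \<or> s' = F)"
      using * T_st[OF 3(3)] 3(1) by simp
    then consider "b = l\<^sub>0" "s' = left \<alpha>" | "b = l\<^sub>1" "s' = right \<alpha>" "s' \<noteq> E" | "b = l\<^sub>1" "s' \<in> {E, F}"
      by blast
    then show ?thesis
    proof cases
      case 1
      then show ?thesis using lift_step_left[OF 3(5-7)] t(1) by auto
    next
      case 2
      then show ?thesis using lift_step_right[OF sim 3(3-7)] t(2) by auto
    next
      \<comment> \<open>The target is a sink: \<open>F\<close> itself, or
        \<open>right \<alpha>\<close> being \<open>E\<close>. The retreat of \<open>t\<close> to
        \<open>F\<close> answers both.\<close>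
      case c: 3
      then show ?thesis using lift_sink[of s' F] t(3) by auto
    qed
  qed
qed

section \<open>Extending simulations on the finite system to stacks\<close>

text \<open>Below a symbol that is not normed nothing is ever exposed, so the rests are arbitrary
  there up to their height. Normedness of \<open>X\<close> decides, not that of \<open>Y\<close>,
  because a pop starts on the simulated side.\<close>

inductive_set stacked :: "'g rel \<Rightarrow> 'g list rel" for R where
  Nil: "([], []) \<in> stacked R"
| Cons: "(X, Y) \<in> R \<Longrightarrow> X \<in> \<Gamma> \<Longrightarrow> Y \<in> \<Gamma> \<Longrightarrow> \<gamma> \<in> lists \<Gamma> \<Longrightarrow> \<delta> \<in> lists \<Gamma> \<Longrightarrow> length \<gamma> = length \<delta> \<Longrightarrow>
    (X \<in> normed \<Delta> \<Longrightarrow> (\<gamma>, \<delta>) \<in> stacked R) \<Longrightarrow> (X # \<gamma>, Y # \<delta>) \<in> stacked R"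

lemma stacked_states: "(\<gamma>, \<delta>) \<in> stacked R \<Longrightarrow> \<gamma> \<in> lists \<Gamma> \<and> \<delta> \<in> lists \<Gamma> \<and> length \<gamma> = length \<delta>"
  by (induction rule: stacked.induct) auto

text \<open>A rule of \<open>Z\<close> would give a transition labelled \<open>f a\<close>, whereas
  the sinks offer only \<open>l\<^sub>2\<close>.\<close>

lemma simulation_T_sink:
  assumes "simulation T R" "(Z, s) \<in> R" "s \<in> {E, F}" "Z \<in> \<Gamma>"
  shows "(Z, a, \<alpha>) \<notin> \<Delta>"
proof
  assume *: "(Z, a, \<alpha>) \<in> \<Delta>"
  then have "(Z, f a, st (Z, a, \<alpha>)) \<in> transitions T"
    using assms T_symbol by blast
  then obtain t where "(s, f a, t) \<in> transitions T"
    using assms unfolding simulation_def by blast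
  then show False
    using T_sink[OF assms(3)] f_fresh[OF *] by blast
qed

text \<open>One rule application corresponds to two steps of \<open>T\<close>: the action and then
  the choice of a half. \<open>F\<close> appears in the last conclusion because the simulating side
  may answer \<open>l\<^sub>1\<close> by the retreat.\<close>

lemma simulation_T_rule:
  assumes sim: "simulation T R" and R: "(X, Y) \<in> R" and Y: "Y \<in> \<Gamma>" and r: "(X, a, \<alpha>) \<in> \<Delta>"
  obtains \<beta> where "(Y, a, \<beta>) \<in> \<Delta>" "length \<beta> = length \<alpha>" "(left \<alpha>, left \<beta>) \<in> R"
    "(right \<alpha>, right \<beta>) \<in> R \<or> (right \<alpha>, F) \<in> R"
proof -
  have "(X, f a, st (X, a, \<alpha>)) \<in> transitions T"
    using r rule_symbols(1) T_symbol by blast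
  then obtain t where "(Y, f a, t) \<in> transitions T" "(st (X, a, \<alpha>), t) \<in> R"
    using sim R unfolding simulation_def by blast
  then obtain \<beta> where \<beta>: "(Y, a, \<beta>) \<in> \<Delta>" "(st (X, a, \<alpha>), st (Y, a, \<beta>)) \<in> R"
    using T_symbol[OF Y] f_inj[OF r] by metis
  have move: "\<exists>t'. (st (Y, a, \<beta>), b, t') \<in> transitions T \<and> (s', t') \<in> R"
    if "(st (X, a, \<alpha>), b, s') \<in> transitions T" for b s'
    using sim \<beta>(2) that unfolding simulation_def by blast
  have "(left \<alpha>, left \<beta>) \<in> R"
    using move[of l\<^sub>0 "left \<alpha>"] T_st[OF r] T_st[OF \<beta>(1)] labels_distinct by auto
  moreover have "(right \<alpha>, right \<beta>) \<in> R \<or> (right \<alpha>, F) \<in> R"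
    using move[of l\<^sub>1 "right \<alpha>"] T_st[OF r] T_st[OF \<beta>(1)] labels_distinct by auto
  ultimately show thesis
    using that \<beta>(1) rule_length[OF \<beta>(1) r] by blast
qed

lemma rule_cases:
  assumes "(X, a, \<alpha>) \<in> \<Delta>" "length \<beta> = length \<alpha>"
  obtains "\<alpha> = []" "\<beta> = []" | U U' where "\<alpha> = [U]" "\<beta> = [U']"
  | U V U' V' where "\<alpha> = [U, V]" "\<beta> = [U', V']"
proof -
  have "length \<alpha> = 0 \<or> length \<alpha> = 1 \<or> length \<alpha> = 2"
    using rule_symbols(3)[OF assms(1)] by linarith
  then show thesis
    using assms(2) that by (elim disjE) (auto simp: length_Suc_conv numeral_2_eq_2)
qed

text \<open>The simulating side could avoid its second symbol only by answering with
  \<open>F\<close>. This is excluded: a normed symbol has a rule and thus does not lie below a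
  sink.\<close>

lemma simulation_T_normed:
  assumes sim: "simulation T R" and "X \<in> normed \<Delta>" "(X, Y) \<in> R" "Y \<in> \<Gamma>"
  shows "Y \<in> normed \<Delta>"
  using assms(2-4)
proof (induction X arbitrary: Y rule: normed.induct)
  case (1 X a \<alpha>)
  obtain \<beta> where \<beta>: "(Y, a, \<beta>) \<in> \<Delta>" "length \<beta> = length \<alpha>" "(left \<alpha>, left \<beta>) \<in> R"
    "(right \<alpha>, right \<beta>) \<in> R \<or> (right \<alpha>, F) \<in> R"
    using simulation_T_rule[OF sim "1.prems" "1.hyps"(1)] .
  from "1.hyps"(1) \<beta>(2) have "set \<beta> \<subseteq> normed \<Delta>"
  proof (cases rule: rule_cases)
    case (2 U U')
    then show ?thesis
      using "1.IH"[of U U'] \<beta>(3) rule_symbols(2)[OF \<beta>(1)] by (simp add: left_def)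
  next
    case (3 U V U' V')
    have U': "U' \<in> normed \<Delta>"
      using 3 "1.IH"[of U U'] \<beta>(3) rule_symbols(2)[OF \<beta>(1)] by (simp add: left_def)
    have "(V, V') \<in> R \<or> (V, F) \<in> R"
      using \<beta>(4) 3 U' "1.hyps"(2) by (simp add: right_def)
    moreover have "(V, F) \<notin> R"
      using simulation_T_sink[OF sim, of V F] rule_symbols(2)[OF "1.hyps"(1)] 3 "1.hyps"(2)[of V]
      by (auto elim: normed.cases)
    ultimately show ?thesis
      using 3 U' "1.IH"[of V V'] rule_symbols(2)[OF \<beta>(1)] by simp
  qed simp
  then show ?case
    using normed.intros[OF \<beta>(1)] by blast
qed

text \<open>\<open>stacked R\<close> compares the rests below a normed \<open>X\<close>, its
  counterpart those below a normed \<open>Y\<close>. As \<open>R'\<close> relates \<open>Y\<close>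
  to \<open>X\<close>, normedness of \<open>Y\<close> passes to \<open>X\<close>, which is the
  direction required.\<close>

lemma stacked_converse:
  assumes sim: "simulation T R'" and sub: "R\<inverse> \<subseteq> R'"
  shows "(stacked R)\<inverse> \<subseteq> stacked R'"
proof -
  have "(\<delta>, \<gamma>) \<in> stacked R'" if "(\<gamma>, \<delta>) \<in> stacked R" for \<gamma> \<delta>
    using that
  proof (induction rule: stacked.induct)
    case (Cons X Y \<gamma> \<delta>)
    then have "(Y, X) \<in> R'" using sub by blast
    then show ?case
      using Cons simulation_T_normed[OF sim] by (auto intro: stacked.Cons)
  qed (rule stacked.Nil)
  then show ?thesis by auto
qed

text \<open>A deadlocked symbol is simulated by the sinks \<open>E\<close> and \<open>F\<close>, so it has to be related to all
  symbols before a simulation on \<open>T\<close> can be transferred. For the finer relations this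
  condition is vacuous.\<close>

definition saturated :: "'g rel \<Rightarrow> bool" where
  "saturated R \<longleftrightarrow> (\<forall>Z \<in> \<Gamma>. \<forall>s \<in> {E, F}. (Z, s) \<in> R \<longrightarrow> {Z} \<times> \<Gamma> \<subseteq> R)"

lemma simulation_stacked:
  assumes sim: "simulation T R" and sat: "saturated R"
  shows "simulation P (stacked R)"
  unfolding simulation_def
proof (intro conjI allI impI)
  show "stacked R \<subseteq> states P \<times> states P"
    unfolding P_states by (rule subrelI) (simp add: stacked_states del: in_lists_conv_set)
next
  fix s t a s'
  assume *: "(s, t) \<in> stacked R \<and> (s, a, s') \<in> transitions P"
  from conjunct1[OF *] show "\<exists>t'. (t, a, t') \<in> transitions P \<and> (s', t') \<in> stacked R"
  proof cases
    case Nil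
    then show ?thesis using * P_Nil by simp
  next
    case (Cons X Y \<gamma> \<delta>)
    obtain \<alpha> where \<alpha>: "(X, a, \<alpha>) \<in> \<Delta>" "s' = \<alpha> @ \<gamma>"
      using * Cons(1) by (auto simp: P_Cons)
    obtain \<beta> where \<beta>: "(Y, a, \<beta>) \<in> \<Delta>" "length \<beta> = length \<alpha>" "(left \<alpha>, left \<beta>) \<in> R"
      "(right \<alpha>, right \<beta>) \<in> R \<or> (right \<alpha>, F) \<in> R"
      using simulation_T_rule[OF sim Cons(3,5) \<alpha>(1)] .
    note syms = rule_symbols(2)[OF \<alpha>(1)] rule_symbols(2)[OF \<beta>(1)]
    have X: "(\<gamma>, \<delta>) \<in> stacked R" if "set \<alpha> \<subseteq> normed \<Delta>"
      using Cons(9) normed.intros[OF \<alpha>(1)] that by blast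
    from \<alpha>(1) \<beta>(2) have "(\<alpha> @ \<gamma>, \<beta> @ \<delta>) \<in> stacked R"
    proof (cases rule: rule_cases)
      case (2 U U')
      then show ?thesis
        using X \<beta>(3) syms Cons by (auto simp: left_def intro!: stacked.Cons)
    next
      case (3 U V U' V')
      \<comment> \<open>\<open>V\<close> may have been matched with \<open>V'\<close>, with
        \<open>F\<close>, or with \<open>E\<close> in case \<open>U'\<close> is not normed.
        Saturation turns a match with a sink into the pair wanted.\<close>
      have "(V, V') \<in> R" if "U \<in> normed \<Delta>"
        using \<beta>(4) 3 that sat syms by (auto simp: right_def saturated_def split: if_splits)
      then have "(V # \<gamma>, V' # \<delta>) \<in> stacked R" if "U \<in> normed \<Delta>"
        using that X 3 syms Cons by (auto intro!: stacked.Cons)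
      then have "(U # V # \<gamma>, U' # V' # \<delta>) \<in> stacked R"
        using 3 \<beta>(3) syms Cons by (intro stacked.Cons[of U]) (simp_all add: left_def)
      then show ?thesis using 3 by simp
    qed (use X in simp)
    then show ?thesis
      using Cons \<alpha> \<beta>(1) by (auto simp: P_Cons)
  qed
qed

text \<open>A symbol below a sink is deadlocked, while the sinks have their
  \<open>l\<^sub>2\<close>-transition. A relation that puts no deadlocked state below a live one
  therefore contains no pair to which saturation applies.\<close>

lemma saturated_if_initials:
  assumes "simulation T R" "\<And>s t. (s, t) \<in> R \<Longrightarrow> initials T s = {} \<Longrightarrow> initials T t = {}"
  shows "saturated R"
  unfolding saturated_def
proof (intro ballI impI)
  fix Z s assume *: "Z \<in> \<Gamma>" "s \<in> {E, F}" "(Z, s) \<in> R"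
  have "initials T Z = {}"
    using simulation_T_sink[OF assms(1) *(3,2,1)] by (simp add: initials_T_symbol[OF *(1)])
  then show "{Z} \<times> \<Gamma> \<subseteq> R"
    using assms(2)[OF *(3)] initials_T_sink[OF *(2)] by simp
qed

lemma saturated_if_converse:
  assumes "simulation T R" "simulation T R'" "R\<inverse> \<subseteq> R'"
  shows "saturated R"
proof (rule saturated_if_initials[OF assms(1)])
  fix s t assume *: "(s, t) \<in> R" "initials T s = {}"
  then have "(t, s) \<in> R'" using assms(3) by blast
  then show "initials T t = {}"
    using assms(2) *(2) unfolding simulation_def initials_def by blast
qed

text \<open>A deadlocked symbol imposes no transfer condition, so it can be put below every symbol.
  This is done for plain simulations only: for the simulation preorder and for the auxiliary
  relation of a 2-nested simulation.\<close>

lemma saturate: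
  assumes sim: "simulation T R"
  obtains R' where "simulation T R'" "saturated R'" "R \<subseteq> R'"
proof
  let ?D = "{Z \<in> \<Gamma>. \<forall>a \<alpha>. (Z, a, \<alpha>) \<notin> \<Delta>}"
  let ?R = "R \<union> ?D \<times> \<Gamma>"
  show sim': "simulation T ?R"
    unfolding simulation_def
  proof (intro conjI allI impI)
    show "?R \<subseteq> states T \<times> states T"
      using sim by (auto simp: simulation_def T_states)
  next
    fix s t a s' assume *: "(s, t) \<in> ?R \<and> (s, a, s') \<in> transitions T"
    then have "(s, t) \<in> R" using T_symbol by blast
    then show "\<exists>t'. (t, a, t') \<in> transitions T \<and> (s', t') \<in> ?R"
      using * sim unfolding simulation_def by blast
  qed
  show "saturated ?R"
    using simulation_T_sink[OF sim] E_notin F_notin unfolding saturated_def by blast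
qed auto

section \<open>Preservation of each preorder and equivalence\<close>

lemma stacked_singleton: "(X, Y) \<in> R \<Longrightarrow> X \<in> \<Gamma> \<Longrightarrow> Y \<in> \<Gamma> \<Longrightarrow> ([X], [Y]) \<in> stacked R"
  using stacked.Cons[of X Y R "[]" "[]"] stacked.Nil by simp

lemma lift_singleton: "([X], [Y]) \<in> R \<Longrightarrow> (X, Y) \<in> lift R"
  using lift_symbol[of "[]" "[]"] by simp

lemma preorder_preserved:
  assumes "\<And>R. K P R \<Longrightarrow> K' T (lift R)"
    and "\<And>R. K' T R \<Longrightarrow> \<exists>R'. R \<subseteq> R' \<and> K P (stacked R')"
    and "X \<in> \<Gamma>" "Y \<in> \<Gamma>"
  shows "preorder_of K P [X] [Y] \<longleftrightarrow> preorder_of K' T X Y"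
proof
  assume "preorder_of K P [X] [Y]"
  then show "preorder_of K' T X Y"
    unfolding preorder_of_def using assms(1) lift_singleton by blast
next
  assume "preorder_of K' T X Y"
  then obtain R where "K' T R" "(X, Y) \<in> R"
    unfolding preorder_of_def by blast
  moreover from this obtain R' where "R \<subseteq> R'" "K P (stacked R')"
    using assms(2) by blast
  ultimately show "preorder_of K P [X] [Y]"
    unfolding preorder_of_def using stacked_singleton assms(3,4) by blast
qed

lemma simulation_preserved:
  assumes "X \<in> \<Gamma>" "Y \<in> \<Gamma>"
  shows "preorder_of simulation P [X] [Y] \<longleftrightarrow> preorder_of simulation T X Y"
proof (rule preorder_preserved[OF _ _ assms])
  show "simulation T (lift R)" if "simulation P R" for R
    using that by (rule simulation_lift)
  show "\<exists>R'. R \<subseteq> R' \<and> simulation P (stacked R')" if "simulation T R" for R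
    using saturate[OF that] simulation_stacked by metis
qed

text \<open>Covers completed and ready simulation, which add a condition on each pair. The condition
  forbids a deadlocked state below a live one, so \<open>R\<close> is saturated as it stands; an
  enlargement could violate the condition.\<close>

lemma constrained_simulation_preserved:
  assumes K: "\<And>R. K P R \<longleftrightarrow> simulation P R \<and> (\<forall>(s, t) \<in> R. C s t)"
    and K': "\<And>R. K' T R \<longleftrightarrow> simulation T R \<and> (\<forall>(s, t) \<in> R. C' s t)"
    and Nil: "C [] []"
    and sink: "\<And>s t. s \<in> {E, F} \<Longrightarrow> t \<in> {E, F} \<Longrightarrow> C' s t"
    and st: "\<And>r r'. r \<in> \<Delta> \<Longrightarrow> r' \<in> \<Delta> \<Longrightarrow> C' (st r) (st r')"
    and symbol: "\<And>X Y \<gamma> \<delta>. X \<in> \<Gamma> \<Longrightarrow> Y \<in> \<Gamma> \<Longrightarrow> \<gamma> \<in> lists \<Gamma> \<Longrightarrow> \<delta> \<in> lists \<Gamma> \<Longrightarrow>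
      C' X Y \<longleftrightarrow> C (X # \<gamma>) (Y # \<delta>)"
    and deadlock: "\<And>s t. C' s t \<Longrightarrow> initials T s = {} \<Longrightarrow> initials T t = {}"
    and XY: "X \<in> \<Gamma>" "Y \<in> \<Gamma>"
  shows "preorder_of K P [X] [Y] \<longleftrightarrow> preorder_of K' T X Y"
proof (rule preorder_preserved[OF _ _ XY])
  fix R assume "K P R"
  then have sim: "simulation P R" and R: "\<And>s t. (s, t) \<in> R \<Longrightarrow> C s t"
    unfolding K by blast+
  have "C' s t" if "(s, t) \<in> lift R" for s t
    using sim that
  proof (cases rule: lift_cases)
    case 1
    then show ?thesis by (rule sink)
  next
    case (2 \<gamma> \<delta>)
    then show ?thesis using symbol R by blast
  next
    case 3
    then show ?thesis by (simp add: st)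
  qed
  then show "K' T (lift R)"
    unfolding K' using simulation_lift[OF sim] by blast
next
  fix R assume "K' T R"
  then have sim: "simulation T R" and R: "\<And>s t. (s, t) \<in> R \<Longrightarrow> C' s t"
    unfolding K' by blast+
  have "C s t" if "(s, t) \<in> stacked R" for s t
    using that
  proof cases
    case Nil
    then show ?thesis by (simp add: assms(3))
  next
    case (Cons X Y \<gamma> \<delta>)
    then show ?thesis using symbol R by blast
  qed
  moreover have "saturated R"
    using saturated_if_initials[OF sim] deadlock R by blast
  ultimately show "\<exists>R'. R \<subseteq> R' \<and> K P (stacked R')"
    unfolding K using simulation_stacked[OF sim] by blast
qed

lemma completed_simulation_preserved:
  assumes "X \<in> \<Gamma>" "Y \<in> \<Gamma>"
  shows "preorder_of completed_simulation P [X] [Y] \<longleftrightarrow> preorder_of completed_simulation T X Y"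
proof (rule constrained_simulation_preserved[where
      C = "\<lambda>s t. initials P s = {} \<longleftrightarrow> initials P t = {}" and
      C' = "\<lambda>s t. initials T s = {} \<longleftrightarrow> initials T t = {}", OF _ _ _ _ _ _ _ assms])
qed (simp_all only: completed_simulation_def initials_T_sink initials_T_st initials_T_symbol
    initials_P_Cons image_is_empty simp_thms)

lemma ready_simulation_preserved:
  assumes "X \<in> \<Gamma>" "Y \<in> \<Gamma>"
  shows "preorder_of ready_simulation P [X] [Y] \<longleftrightarrow> preorder_of ready_simulation T X Y"
proof (rule constrained_simulation_preserved[where C = "\<lambda>s t. initials P s = initials P t" and
      C' = "\<lambda>s t. initials T s = initials T t", OF _ _ _ _ _ _ _ assms])
qed (rule initials_T_eq_iff, assumption+ |
    simp only: ready_simulation_def initials_T_sink initials_T_st)+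

lemma two_nested_simulation_preserved:
  assumes "X \<in> \<Gamma>" "Y \<in> \<Gamma>"
  shows "preorder_of two_nested_simulation P [X] [Y] \<longleftrightarrow> preorder_of two_nested_simulation T X Y"
proof (rule preorder_preserved[OF _ _ assms])
  show "two_nested_simulation T (lift R)" if "two_nested_simulation P R" for R
  proof -
    obtain R' where "simulation P R" "simulation P R'" "R\<inverse> \<subseteq> R'"
      using \<open>two_nested_simulation P R\<close> by (auto simp: two_nested_simulation_def)
    then show ?thesis
      using simulation_lift lift_mono[of "R\<inverse>" R'] lift_converse[of R]
      unfolding two_nested_simulation_def by auto
  qed
  show "\<exists>R'. R \<subseteq> R' \<and> two_nested_simulation P (stacked R')" if "two_nested_simulation T R" for R
  proof -
    obtain R' where sim: "simulation T R" "simulation T R'" "R\<inverse> \<subseteq> R'"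
      using \<open>two_nested_simulation T R\<close> by (auto simp: two_nested_simulation_def)
    \<comment> \<open>Only the auxiliary simulation is enlarged, since enlarging \<open>R\<close>
      could spoil the inclusion of its converse. \<open>R\<close> is saturated by
      \<open>saturated_if_converse\<close>.\<close>
    obtain R'' where R'': "simulation T R''" "saturated R''" "R' \<subseteq> R''"
      using saturate[OF sim(2)] .
    have "(stacked R)\<inverse> \<subseteq> stacked R''"
      using stacked_converse[OF R''(1)] sim(3) R''(3) by blast
    then show ?thesis
      using simulation_stacked[OF sim(1) saturated_if_converse[OF sim]] simulation_stacked[OF R''(1,2)]
      unfolding two_nested_simulation_def by blast
  qed
qed

lemma bisimulation_preserved:
  assumes "X \<in> \<Gamma>" "Y \<in> \<Gamma>"
  shows "preorder_of bisimulation P [X] [Y] \<longleftrightarrow> preorder_of bisimulation T X Y"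
proof (rule preorder_preserved[OF _ _ assms])
  show "bisimulation T (lift R)" if "bisimulation P R" for R
    using that simulation_lift lift_converse by (simp add: bisimulation_def)
  show "\<exists>R'. R \<subseteq> R' \<and> bisimulation P (stacked R')" if "bisimulation T R" for R
  proof -
    have R: "simulation T R" "R\<inverse> = R"
      using that by (auto simp: bisimulation_def)
    have "(stacked R)\<inverse> \<subseteq> stacked R"
      using stacked_converse[OF R(1)] R(2) by blast
    then have "(stacked R)\<inverse> = stacked R" by auto
    then show ?thesis
      using simulation_stacked[OF R(1) saturated_if_converse[OF R(1,1)]] R(2)
      unfolding bisimulation_def by blast
  qed
qed

theorem related_preserved:
  assumes "X \<in> \<Gamma>" "Y \<in> \<Gamma>"
  shows "related b P [X] [Y] \<longleftrightarrow> related b T X Y"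
  using assms by (cases b) (simp_all add: equivalence_of_def simulation_preserved
    completed_simulation_preserved ready_simulation_preserved two_nested_simulation_preserved
    bisimulation_preserved)

end

section \<open>Program verification\<close>

text \<open>A functional interpreter lets straight-line code be evaluated by simplification instead
  of by the rules of \<open>exec\<close>. Its values for \<open>Loop\<close> and for reading from
  empty input are arbitrary; \<open>loop_free_ok\<close> excludes both.\<close>

fun loop_free_run :: "ram \<Rightarrow> ram_config \<Rightarrow> ram_config" where
  "loop_free_run (Const i n) (m, u, v) = (m(i := n), u, v)"
| "loop_free_run (Add i j k) (m, u, v) = (m(i := m j + m k), u, v)"
| "loop_free_run (Sub i j k) (m, u, v) = (m(i := m j - m k), u, v)"
| "loop_free_run (Load i j) (m, u, v) = (m(i := m (m j)), u, v)"
| "loop_free_run (Store i j) (m, u, v) = (m(m i := m j), u, v)"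
| "loop_free_run (Read i) (m, u, v) = (m(i := hd u), tl u, v)"
| "loop_free_run (Print i) (m, u, v) = (m, u, v @ [m i])"
| "loop_free_run (Seq p q) c = loop_free_run q (loop_free_run p c)"
| "loop_free_run (Cond i p q) (m, u, v) =
     (if m i \<noteq> 0 then loop_free_run p (m, u, v) else loop_free_run q (m, u, v))"
| "loop_free_run (Loop i p) c = c"

fun loop_free_ok :: "ram \<Rightarrow> ram_config \<Rightarrow> bool" where
  "loop_free_ok (Read i) (m, u, v) \<longleftrightarrow> u \<noteq> []"
| "loop_free_ok (Seq p q) c \<longleftrightarrow> loop_free_ok p c \<and> loop_free_ok q (loop_free_run p c)"
| "loop_free_ok (Cond i p q) (m, u, v) \<longleftrightarrow>
     (if m i \<noteq> 0 then loop_free_ok p (m, u, v) else loop_free_ok q (m, u, v))"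
| "loop_free_ok (Loop i p) c \<longleftrightarrow> False"
| "loop_free_ok _ c \<longleftrightarrow> True"

fun cost :: "ram \<Rightarrow> nat" where
  "cost (Seq p q) = cost p + cost q"
| "cost (Cond i p q) = 1 + max (cost p) (cost q)"
| "cost _ = 1"

lemma exec_loop_free: "loop_free_ok p c \<Longrightarrow> \<exists>n \<le> cost p. exec p c n (loop_free_run p c)"
proof (induction p c rule: loop_free_run.induct)
  case (6 i m u v)
  then show ?case
    using exec.Read[of i m "hd u" "tl u" v] by auto
next
  case (8 p q c)
  then obtain n n' where "n \<le> cost p" "exec p c n (loop_free_run p c)"
    "n' \<le> cost q" "exec q (loop_free_run p c) n' (loop_free_run q (loop_free_run p c))"
    by auto
  then have "exec (Seq p q) c (n + n') (loop_free_run (Seq p q) c)" "n + n' \<le> cost (Seq p q)"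
    by (simp_all add: exec.Seq)
  then show ?case by blast
next
  case (9 i p q m u v)
  show ?case
  proof (cases "m i = 0")
    case True
    then obtain n where "n \<le> cost q" "exec q (m, u, v) n (loop_free_run q (m, u, v))"
      using 9 by auto
    then show ?thesis
      using exec.Cond_False[of m i q u v n "loop_free_run q (m, u, v)" p] True by (intro exI[of _ "1 + n"]) simp
  next
    case False
    then obtain n where "n \<le> cost p" "exec p (m, u, v) n (loop_free_run p (m, u, v))"
      using 9 by auto
    then show ?thesis
      using exec.Cond_True[of m i p u v n "loop_free_run p (m, u, v)" q] False by (intro exI[of _ "1 + n"]) simp
  qed
qed (auto intro: exec.Const[unfolded One_nat_def] exec.Add[unfolded One_nat_def]
    exec.Sub[unfolded One_nat_def] exec.Load[unfolded One_nat_def]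
    exec.Store[unfolded One_nat_def] exec.Print[unfolded One_nat_def])

text \<open>Total correctness with a time bound. A single run within the bound suffices, as
  \<open>outputs_in\<close> asks for no more.\<close>

definition reaches :: "ram \<Rightarrow> ram_config \<Rightarrow> nat \<Rightarrow> (ram_config \<Rightarrow> bool) \<Rightarrow> bool" where
  "reaches p c t Q \<longleftrightarrow> (\<exists>n c'. exec p c n c' \<and> n \<le> t \<and> Q c')"

lemma reaches_loop_free:
  "loop_free_ok p c \<Longrightarrow> Q (loop_free_run p c) \<Longrightarrow> cost p \<le> t \<Longrightarrow> reaches p c t Q"
  using exec_loop_free[of p c] order_trans unfolding reaches_def by blast

lemma reaches_Seq:
  assumes "reaches p c t Q" "\<And>c'. Q c' \<Longrightarrow> reaches q c' t' Q'"
  shows "reaches (Seq p q) c (t + t') Q'"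
proof -
  obtain n c' where 1: "exec p c n c'" "n \<le> t" "Q c'"
    using assms(1) unfolding reaches_def by blast
  obtain n' c'' where "exec q c' n' c''" "n' \<le> t'" "Q' c''"
    using assms(2)[OF 1(3)] unfolding reaches_def by blast
  then show ?thesis
    using exec.Seq[OF 1(1)] 1(2) add_mono unfolding reaches_def by blast
qed

lemma reaches_mono:
  "reaches p c t Q \<Longrightarrow> t \<le> t' \<Longrightarrow> (\<And>c'. Q c' \<Longrightarrow> Q' c') \<Longrightarrow> reaches p c t' Q'"
  unfolding reaches_def using order_trans by blast

text \<open>The index \<open>d\<close> is a potential lowered by every iteration, so at most
  \<open>d\<close> iterations occur, each costing \<open>t\<close> and one test. The final
  \<open>1\<close> is the test that leaves the loop. This form allows amortised bounds.\<close>

lemma reaches_Loop: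
  assumes step: "\<And>d c. Inv d c \<Longrightarrow> fst c i \<noteq> 0 \<Longrightarrow> reaches p c t (\<lambda>c'. \<exists>d' < d. Inv d' c')"
    and init: "Inv d c"
  shows "reaches (Loop i p) c ((t + 1) * d + 1) (\<lambda>c'. (\<exists>d'. Inv d' c') \<and> fst c' i = 0)"
  using init
proof (induction d arbitrary: c rule: less_induct)
  case (less d)
  obtain m u v where c: "c = (m, u, v)" by (cases c)
  show ?case
  proof (cases "m i = 0")
    case True
    then have "exec (Loop i p) c 1 c"
      using exec.Loop_False c by simp
    then show ?thesis
      using True less.prems c unfolding reaches_def by (intro exI[of _ 1] exI[of _ c]) auto
  next
    case False
    obtain n c' d' where 1: "exec p c n c'" "n \<le> t" "d' < d" "Inv d' c'"
      using step[OF less.prems] False c unfolding reaches_def by auto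
    obtain n' c'' where 2: "exec (Loop i p) c' n' c''" "n' \<le> (t + 1) * d' + 1"
      "(\<exists>d'. Inv d' c'') \<and> fst c'' i = 0"
      using less.IH[OF 1(3,4)] unfolding reaches_def by blast
    have "exec (Loop i p) c (1 + n + n') c''"
      using exec.Loop_True[of m i] False 1(1) 2(1) c by blast
    moreover have "1 + n + n' \<le> (t + 1) * d + 1"
    proof -
      have "(t + 1) * (d' + 1) \<le> (t + 1) * d"
        using 1(3) by (intro mult_le_mono) auto
      then show ?thesis using 1(2) 2(2) by simp
    qed
    ultimately show ?thesis
      using 2(3) unfolding reaches_def by blast
  qed
qed

text \<open>Cells 0 to 15 are registers; the remaining memory is split into 16 interleaved arrays,
  which are indexed by symbols, actions or rule numbers. Registers 14 and 15 are scratch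
  registers for address computations.\<close>

definition cell :: "nat \<Rightarrow> nat \<Rightarrow> nat" where
  "cell k x = 16 * x + 16 + k"

definition arr :: "(nat \<Rightarrow> nat) \<Rightarrow> nat \<Rightarrow> nat \<Rightarrow> nat" where
  "arr m k = (\<lambda>x. m (cell k x))"

lemma cell_eq_iff:
  assumes "k < 16" "l < 16"
  shows "cell k x = cell l y \<longleftrightarrow> k = l \<and> x = y"
proof
  assume *: "cell k x = cell l y"
  have "cell k x = k + 16 * (x + 1)" for k x
    by (simp add: cell_def)
  then have "cell k x mod 16 = k mod 16" for k x
    by (simp only: mod_mult_self2)
  from this[of k x] this[of l y] have "k = l"
    using * assms by simp
  with * show "k = l \<and> x = y" by (simp add: cell_def)
qed simp

lemma cell_neq_register: "i < 16 \<Longrightarrow> cell k x \<noteq> i" "i < 16 \<Longrightarrow> i \<noteq> cell k x"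
  unfolding cell_def by auto

lemma arr_register: "i < 16 \<Longrightarrow> arr (m(i := n)) k = arr m k"
  unfolding arr_def by (auto simp: cell_neq_register)

lemma arr_cell: "k < 16 \<Longrightarrow> l < 16 \<Longrightarrow>
    arr (m(cell k x := n)) l = (if k = l then (arr m l)(x := n) else arr m l)"
  unfolding arr_def by (auto simp: cell_eq_iff)

lemma cell_eq_arr: "m (cell k x) = arr m k x"
  by (simp add: arr_def)

text \<open>The machine has no empty instruction; clearing the scratch register 14 stands in for it,
  at the price of one step per block.\<close>

fun block :: "ram list \<Rightarrow> ram" where
  "block [] = Const 14 0"
| "block (p # ps) = Seq p (block ps)"

text \<open>Four doublings produce the factor 16 of \<open>cell\<close>, since there is no
  multiplication.\<close>

definition address :: "nat \<Rightarrow> nat \<Rightarrow> ram" where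
  "address k x = block [Add 15 x x, Add 15 15 15, Add 15 15 15, Add 15 15 15,
     Const 14 (16 + k), Add 15 15 14]"

definition fetch :: "nat \<Rightarrow> nat \<Rightarrow> nat \<Rightarrow> ram" where
  "fetch i k x = Seq (address k x) (Load i 15)"

definition put :: "nat \<Rightarrow> nat \<Rightarrow> nat \<Rightarrow> ram" where
  "put k x i = Seq (address k x) (Store 15 i)"

lemma address_run:
  "x < 14 \<Longrightarrow> loop_free_run (address k x) (m, u, v) = (m(15 := cell k (m x), 14 := 0), u, v)"
  by (auto simp: address_def cell_def fun_eq_iff)

lemma fetch_run: "x < 14 \<Longrightarrow> loop_free_run (fetch i k x) (m, u, v) =
    (m(15 := cell k (m x), 14 := 0, i := arr m k (m x)), u, v)"
  by (simp add: fetch_def address_run cell_neq_register cell_eq_arr arr_register)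

lemma put_run: "x < 14 \<Longrightarrow> i < 14 \<Longrightarrow> loop_free_run (put k x i) (m, u, v) =
    (m(15 := cell k (m x), 14 := 0, cell k (m x) := m i), u, v)"
  by (simp add: put_def address_run)

lemma fetch_put_ok: "loop_free_ok (fetch i k x) c" "loop_free_ok (put k x i) c"
  by (cases c; simp add: fetch_def put_def address_def)+

lemma fetch_put_cost: "cost (fetch i k x) = 8" "cost (put k x i) = 8"
  by (simp_all add: fetch_def put_def address_def)

lemmas run_simps = fetch_run put_run fetch_put_ok fetch_put_cost cell_neq_register cell_eq_iff
  arr_register arr_cell

text \<open>The loop register counts down while the invariant counts up. It also serves as array
  index, which is why entry \<open>j\<close> of an input list is stored at
  \<open>N - j\<close>.\<close>

lemma reaches_count:
  assumes step: "\<And>j m u v. j < N \<Longrightarrow> Inv j (m, u, v) \<Longrightarrow> m i = N - j \<Longrightarrow>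
      reaches p (m, u, v) t (\<lambda>c'. Inv (Suc j) c' \<and> fst c' i = N - Suc j)"
    and init: "Inv 0 c" "fst c i = N"
  shows "reaches (Loop i p) c ((t + 1) * N + 1) (Inv N)"
proof -
  let ?Inv = "\<lambda>d c. d \<le> N \<and> Inv (N - d) c \<and> fst c i = d"
  have "reaches (Loop i p) c ((t + 1) * N + 1) (\<lambda>c'. (\<exists>d'. ?Inv d' c') \<and> fst c' i = 0)"
  proof (rule reaches_Loop[of ?Inv])
    fix d c assume *: "?Inv d c" "fst c i \<noteq> 0"
    obtain m u v where c: "c = (m, u, v)" by (cases c)
    have "reaches p c t (\<lambda>c'. Inv (Suc (N - d)) c' \<and> fst c' i = N - Suc (N - d))"
      unfolding c by (rule step) (use * c in auto)
    then show "reaches p c t (\<lambda>c'. \<exists>d' < d. ?Inv d' c')"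
      by (rule reaches_mono) (use * in \<open>auto intro!: exI[of _ "d - 1"] simp: Suc_diff_le\<close>)
  qed (use init in auto)
  then show ?thesis
    by (rule reaches_mono) auto
qed

section \<open>Linked lists and the marking of normed symbols\<close>

fun chain :: "(nat \<Rightarrow> nat) \<Rightarrow> nat \<Rightarrow> nat list \<Rightarrow> bool" where
  "chain f p [] \<longleftrightarrow> p = 0"
| "chain f p (k # ks) \<longleftrightarrow> p = k \<and> k \<noteq> 0 \<and> chain f (f k) ks"

text \<open>Only the set of entries is recorded, since the order of processing is immaterial.
  Distinctness ensures that popping the head removes it from the set.\<close>

definition linked :: "(nat \<Rightarrow> nat) \<Rightarrow> nat \<Rightarrow> nat set \<Rightarrow> bool" where
  "linked f p K \<longleftrightarrow> (\<exists>ks. chain f p ks \<and> distinct ks \<and> set ks = K)"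

lemma chain_upd: "k \<notin> set ks \<Longrightarrow> chain (f(k := n)) p ks = chain f p ks"
  by (induction ks arbitrary: p) auto

lemma linked_Nil: "linked f 0 {}"
  unfolding linked_def by (intro exI[of _ "[]"]) auto

lemma linked_zero: "linked f 0 K \<Longrightarrow> K = {}"
  unfolding linked_def by (metis chain.simps(2) list.exhaust list.set(1))

lemma linked_pop:
  assumes "linked f p K" "p \<noteq> 0"
  shows "p \<in> K" "linked f (f p) (K - {p})"
proof -
  obtain ks where ks: "chain f p ks" "distinct ks" "set ks = K"
    using assms(1) by (auto simp: linked_def)
  then obtain ks' where "ks = p # ks'"
    using assms(2) by (cases ks) auto
  with ks show "p \<in> K" "linked f (f p) (K - {p})"
    unfolding linked_def by (auto intro!: exI[of _ ks'])
qed

lemma linked_upd: "linked f p K \<Longrightarrow> k \<notin> K \<Longrightarrow> linked (f(k := n)) p K"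
  unfolding linked_def using chain_upd by blast

lemma linked_push:
  assumes "linked f p K" "k \<notin> K" "k \<noteq> 0"
  shows "linked (f(k := p)) k (insert k K)"
proof -
  obtain ks where "chain f p ks" "distinct ks" "set ks = K"
    using assms(1) by (auto simp: linked_def)
  then show ?thesis
    unfolding linked_def using assms(2,3) chain_upd by (intro exI[of _ "k # ks"]) auto
qed

lemma linked_down:
  assumes "\<And>k. 0 < k \<Longrightarrow> k \<le> n \<Longrightarrow> f k = k - 1"
  shows "linked f n {1..n}"
proof -
  have "chain f n (rev [1..<Suc n])"
    using assms by (induction n) auto
  then show ?thesis
    unfolding linked_def by (intro exI[of _ "rev [1..<Suc n]"]) auto
qed

section \<open>Closure under Horn rules with an amortised time bound\<close>

datatype position = Pending | Watching nat | Done

text \<open>Right-hand sides are padded to two symbols \<open>A k\<close> and \<open>B k\<close> by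
  \<open>S\<close>, which is marked from the start; lengths 0, 1 and 2 then need no
  distinction.\<close>

locale marking =
  fixes n :: nat and S :: nat and L A B :: "nat \<Rightarrow> nat"
begin

inductive_set derivable :: "nat set" where
  base: "S \<in> derivable"
| rule: "0 < k \<Longrightarrow> k \<le> n \<Longrightarrow> A k \<in> derivable \<Longrightarrow> B k \<in> derivable \<Longrightarrow> L k \<in> derivable"

text \<open>A rule whose right-hand side is not completely marked waits in the list of one unmarked
  symbol of that side. The set \<open>Q\<close> holds the successors of the marked symbols whose lists are
  still to be released.\<close>

definition invariant :: "nat set \<Rightarrow> (nat \<Rightarrow> position) \<Rightarrow> nat set \<Rightarrow> bool" where
  "invariant M pos Q \<longleftrightarrow> S \<in> M \<and> M \<subseteq> derivable \<and> Q \<subseteq> Suc ` M \<and> finite Q \<and>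
     (\<forall>k \<in> {1..n}. pos k = Done \<longrightarrow> L k \<in> M) \<and>
     (\<forall>k \<in> {1..n}. \<forall>y. pos k = Watching y \<longrightarrow> (y = A k \<or> y = B k) \<and> (y \<notin> M \<or> Suc y \<in> Q))"

definition unmarked :: "nat set \<Rightarrow> nat \<Rightarrow> nat" where
  "unmarked M k = of_bool (A k \<notin> M) + of_bool (B k \<notin> M)"

text \<open>Parking a pending rule lowers its summand from 2 to 1. When the awaited symbol is
  marked, the summand returns to 2, but \<open>unmarked\<close> drops by at least 1 and its factor 2
  covers the rise. Releasing a list then changes no weight, whatever its length, and is paid by
  \<open>card Q\<close>. Finishing a rule frees at least 2, enough for one new entry of
  \<open>Q\<close>.\<close>

definition weight :: "nat set \<Rightarrow> (nat \<Rightarrow> position) \<Rightarrow> nat \<Rightarrow> nat" where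
  "weight M pos k = (case pos k of Done \<Rightarrow> 0 | Pending \<Rightarrow> 2 * unmarked M k + 2
     | Watching y \<Rightarrow> 2 * unmarked M k + (if y \<in> M then 2 else 1))"

definition potential :: "nat set \<Rightarrow> (nat \<Rightarrow> position) \<Rightarrow> nat set \<Rightarrow> nat" where
  "potential M pos Q = (\<Sum>k \<in> {1..n}. weight M pos k) + card Q"

lemma potential_initial: "potential M (\<lambda>_. Pending) {} \<le> 6 * n"
proof -
  have "(\<Sum>k \<in> {1..n}. weight M (\<lambda>_. Pending) k) \<le> (\<Sum>k \<in> {1..n}. 6)"
    by (intro sum_mono) (auto simp: weight_def unmarked_def)
  then show ?thesis by (simp add: potential_def)
qed

lemma sum_weight_decrease:
  assumes "k \<in> {1..n}" "\<And>j. j \<in> {1..n} \<Longrightarrow> j \<noteq> k \<Longrightarrow> weight M' pos' j \<le> weight M pos j"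
    and "weight M' pos' k + c \<le> weight M pos k"
  shows "(\<Sum>j \<in> {1..n}. weight M' pos' j) + c \<le> (\<Sum>j \<in> {1..n}. weight M pos j)"
proof -
  have "(\<Sum>j \<in> {1..n} - {k}. weight M' pos' j) \<le> (\<Sum>j \<in> {1..n} - {k}. weight M pos j)"
    using assms(2) by (intro sum_mono) auto
  then show ?thesis
    using assms(1,3) sum.remove[of "{1..n}" k "weight M' pos'"] sum.remove[of "{1..n}" k "weight M pos"]
    by simp
qed

lemma watch:
  assumes inv: "invariant M pos Q" and k: "k \<in> {1..n}" "pos k = Pending"
    and y: "y = A k \<or> y = B k" "y \<notin> M"
  shows "invariant M (pos(k := Watching y)) Q"
    and "potential M (pos(k := Watching y)) Q < potential M pos Q"
proof -
  show "invariant M (pos(k := Watching y)) Q"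
    using inv y unfolding invariant_def by auto
  have "(\<Sum>j \<in> {1..n}. weight M (pos(k := Watching y)) j) + 1 \<le> (\<Sum>j \<in> {1..n}. weight M pos j)"
    using y(2) k by (intro sum_weight_decrease[OF k(1)]) (auto simp: weight_def)
  then show "potential M (pos(k := Watching y)) Q < potential M pos Q"
    by (simp add: potential_def)
qed

lemma finish_marked:
  assumes inv: "invariant M pos Q" and k: "k \<in> {1..n}" "pos k = Pending" and "L k \<in> M"
  shows "invariant M (pos(k := Done)) Q" and "potential M (pos(k := Done)) Q < potential M pos Q"
proof -
  show "invariant M (pos(k := Done)) Q"
    using inv assms(4) unfolding invariant_def by auto
  have "(\<Sum>j \<in> {1..n}. weight M (pos(k := Done)) j) + 1 \<le> (\<Sum>j \<in> {1..n}. weight M pos j)"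
    using k by (intro sum_weight_decrease[OF k(1)]) (auto simp: weight_def)
  then show "potential M (pos(k := Done)) Q < potential M pos Q"
    by (simp add: potential_def)
qed

lemma finish_unmarked:
  assumes inv: "invariant M pos Q" and k: "k \<in> {1..n}" "pos k = Pending"
    and AB: "A k \<in> M" "B k \<in> M" and new: "L k \<notin> M"
  defines "M' \<equiv> insert (L k) M" and "Q' \<equiv> insert (Suc (L k)) Q"
  shows "invariant M' (pos(k := Done)) Q'" and "potential M' (pos(k := Done)) Q' < potential M pos Q"
proof -
  have "L k \<in> derivable"
    using derivable.rule[of k] k(1) AB inv unfolding invariant_def by auto
  then show "invariant M' (pos(k := Done)) Q'"
    using inv unfolding invariant_def M'_def Q'_def by auto
  have "weight M' (pos(k := Done)) j \<le> weight M pos j" if "j \<in> {1..n}" "j \<noteq> k" for j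
  proof (cases "pos j")
    case (Watching y)
    then have "y = A j \<or> y = B j"
      using inv that(1) unfolding invariant_def by blast
    then show ?thesis
      using Watching that(2) new by (auto simp: weight_def unmarked_def M'_def)
  qed (use that in \<open>auto simp: weight_def unmarked_def M'_def\<close>)
  then have "(\<Sum>j \<in> {1..n}. weight M' (pos(k := Done)) j) + 2 \<le> (\<Sum>j \<in> {1..n}. weight M pos j)"
    using k(2) by (intro sum_weight_decrease[OF k(1)]) (simp_all add: weight_def)
  moreover have "card Q' \<le> card Q + 1"
    unfolding Q'_def by (simp add: card_insert_le_m1 card_insert_if)
  ultimately show "potential M' (pos(k := Done)) Q' < potential M pos Q"
    by (simp add: potential_def)
qed

definition release :: "nat \<Rightarrow> (nat \<Rightarrow> position) \<Rightarrow> nat \<Rightarrow> position" where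
  "release y pos k = (if pos k = Watching y then Pending else pos k)"

lemma release:
  assumes inv: "invariant M pos Q" and y: "Suc y \<in> Q"
  shows "invariant M (release y pos) (Q - {Suc y})"
    and "potential M (release y pos) (Q - {Suc y}) < potential M pos Q"
proof -
  show "invariant M (release y pos) (Q - {Suc y})"
    using inv unfolding invariant_def release_def by auto
  have "y \<in> M"
    using inv y unfolding invariant_def by auto
  then have "weight M (release y pos) k = weight M pos k" for k
    by (auto simp: weight_def release_def split: position.split)
  moreover have "card (Q - {Suc y}) < card Q"
    using inv y unfolding invariant_def by (intro psubset_card_mono) auto
  ultimately show "potential M (release y pos) (Q - {Suc y}) < potential M pos Q"
    by (simp add: potential_def)
qed

text \<open>With \<open>Q\<close> empty every watched symbol is unmarked, so its rule does not
  apply, and a finished rule has a marked left-hand side. Thus \<open>M\<close> is closed under the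
  rules.\<close>

lemma invariant_final:
  assumes inv: "invariant M pos {}" and pos: "\<And>k. k \<in> {1..n} \<Longrightarrow> pos k \<noteq> Pending"
  shows "M = derivable"
proof -
  have "x \<in> M" if "x \<in> derivable" for x
    using that
  proof induction
    case base
    then show ?case using inv by (simp add: invariant_def)
  next
    case (rule k)
    then show ?case
      using inv pos[of k] unfolding invariant_def by (cases "pos k") auto
  qed
  then show ?thesis
    using inv unfolding invariant_def by blast
qed

end

section \<open>The program\<close>

text \<open>Register \<open>zero\<close> is never written.\<close>

abbreviation (input) "one \<equiv> 2 :: nat"
abbreviation (input) "zero \<equiv> 3 :: nat"
abbreviation (input) "base \<equiv> 4 :: nat"
abbreviation (input) "nsym \<equiv> 5 :: nat"
abbreviation (input) "nrule \<equiv> 6 :: nat"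
abbreviation (input) "ctr \<equiv> 7 :: nat"
abbreviation (input) "cur \<equiv> 8 :: nat"
abbreviation (input) "tos \<equiv> 9 :: nat"
abbreviation (input) "rx \<equiv> 10 :: nat"
abbreviation (input) "ry \<equiv> 11 :: nat"
abbreviation (input) "rz \<equiv> 12 :: nat"
abbreviation (input) "rg \<equiv> 13 :: nat"

text \<open>Rules are numbered downwards from \<open>nrule\<close> to 1 in the order of input, and 0 ends a linked
  list. The arrays \<open>mark\<close> and \<open>watch\<close> are indexed by symbols, \<open>repr\<close> by actions, and \<open>link\<close> by
  the successors of symbols, since a symbol may be 0.\<close>

abbreviation (input) "syms \<equiv> 2 :: nat"
abbreviation (input) "lhs \<equiv> 3 :: nat"
abbreviation (input) "act \<equiv> 4 :: nat"
abbreviation (input) "fsts \<equiv> 5 :: nat"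
abbreviation (input) "snds \<equiv> 6 :: nat"
abbreviation (input) "repr \<equiv> 7 :: nat"
abbreviation (input) "mark \<equiv> 8 :: nat"
abbreviation (input) "nxt \<equiv> 9 :: nat"
abbreviation (input) "watch \<equiv> 10 :: nat"
abbreviation (input) "link \<equiv> 11 :: nat"

definition init_symbols :: ram where
  "init_symbols = block [Const one 1, Const base 1, Read nsym, Add ctr nsym zero]"

definition read_symbol :: ram where
  "read_symbol = block [Read rx, put syms ctr rx, Add base base rx, Sub ctr ctr one]"

definition init_rules :: ram where
  "init_rules = block [put mark base one, Read nrule, Add ctr nrule zero]"

text \<open>Setting \<open>ry\<close> and \<open>rz\<close> to \<open>base\<close> beforehand pads
  short right-hand sides with the fresh symbol. A later rule with the same action overwrites the
  entry of \<open>repr\<close>; any rule with that action may represent it.\<close>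

definition read_rule :: ram where
  "read_rule = block [Read rx, put lhs ctr rx, Read rx, put act ctr rx, put repr rx ctr,
     Read rg, Add ry base zero, Add rz base zero,
     Cond rg (block [Read ry, Sub rg rg one, Cond rg (Read rz) (block [])]) (block []),
     put fsts ctr ry, put snds ctr rz, Sub rx ctr one, put nxt ctr rx, Add ctr rx zero]"

definition init_marking :: ram where
  "init_marking = block [Add cur nrule zero, Add rg nrule zero]"

definition attach :: ram where
  "attach = block [fetch rz watch ry, put nxt ctr rz, put watch ry ctr]"

text \<open>No list is traversed within a step. Lists are released only when nothing is pending, so
  the whole list of a marked symbol becomes the pending list by one assignment to
  \<open>cur\<close>. \<open>tos\<close> heads a stack threaded through \<open>link\<close>, and
  \<open>rg\<close> is nonzero as long as either kind of work is left.\<close>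

definition marking_step :: ram where
  "marking_step = block [
     Cond cur
       (block [Add ctr cur zero, fetch cur nxt ctr, fetch ry fsts ctr, fetch rz mark ry,
          Cond rz
            (block [fetch ry snds ctr, fetch rz mark ry,
               Cond rz
                 (block [fetch rx lhs ctr, fetch rz mark rx,
                    Cond rz (block [])
                      (block [put mark rx one, Add rx rx one, put link rx tos, Add tos rx zero])])
                 attach])
            attach])
       (block [Sub ry tos one, fetch tos link tos, fetch cur watch ry, put watch ry zero]),
     Add rg cur tos]"

definition init_print_symbols :: ram where
  "init_print_symbols = block [Add rg nsym nrule, Const rz 2, Add rg rg rz, Print rg,
     Add ctr nsym zero]"

definition print_symbol :: ram where
  "print_symbol = block [fetch rx syms ctr, Print rx, Sub ctr ctr one]"

definition init_print_fresh :: ram where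
  "init_print_fresh = block [Add rx base zero, Add ctr nrule rz]"

definition print_next :: ram where
  "print_next = block [Print rx, Add rx rx one, Sub ctr ctr one]"

definition init_print_labels :: ram where
  "init_print_labels = block [Const rx 0, Add ctr nrule rz, Add ctr ctr one, Print ctr]"

definition init_print_transitions :: ram where
  "init_print_transitions = block [Add rg nrule nrule, Add rg rg rg, Add rg rg rz, Print rg,
     Add ry base one, Print base, Print rz, Print ry, Print ry, Print rz, Print ry,
     Add ctr nrule zero]"

text \<open>The intermediate state of rule number \<open>ctr\<close> is \<open>ry + ctr\<close>,
  above the sinks \<open>base\<close> and \<open>ry\<close>. For right-hand sides with fewer than
  two symbols \<open>snds\<close> contains \<open>base\<close>, so both branches of the test on
  \<open>mark\<close> give the right target.\<close>

definition print_rule :: ram where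
  "print_rule = block [Add rg ry ctr,
     fetch rx lhs ctr, Print rx, fetch rx act ctr, fetch rx repr rx, Add rx rx rz, Print rx, Print rg,
     Print rg, Print zero, fetch rx fsts ctr, Print rx,
     fetch cur mark rx, Cond cur (fetch tos snds ctr) (Add tos base zero),
     Print rg, Print one, Print tos,
     Print rg, Print one, Print ry,
     Sub ctr ctr one]"

definition program :: ram where
  "program = block [
     Seq init_symbols (Loop ctr read_symbol),
     Seq init_rules (Loop ctr read_rule),
     Seq init_marking (Loop rg marking_step),
     Seq init_print_symbols (Loop ctr print_symbol),
     Seq init_print_fresh (Loop ctr print_next),
     Seq init_print_labels (Loop ctr print_next),
     Seq init_print_transitions (Loop ctr print_rule)]"

text \<open>The sum bounds every symbol and costs one addition per symbol during reading, with no
  comparison.\<close>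

definition fresh :: "nat list \<Rightarrow> nat" where
  "fresh gs = sum_list gs + 1"

definition first :: "nat \<Rightarrow> nat list \<Rightarrow> nat" where
  "first s \<alpha> = (if \<alpha> = [] then s else hd \<alpha>)"

definition second :: "nat \<Rightarrow> nat list \<Rightarrow> nat" where
  "second s \<alpha> = (if length \<alpha> = 2 then \<alpha> ! 1 else s)"

abbreviation encode_rule :: "(nat, nat) rule \<Rightarrow> nat list" where
  "encode_rule \<equiv> \<lambda>(X, a, \<alpha>). [X, a] @ encode_list (\<lambda>Y. [Y]) \<alpha>"

section \<open>Correctness of the reading phase\<close>

definition symbols_stored :: "nat list \<Rightarrow> nat \<Rightarrow> (nat \<Rightarrow> nat) \<Rightarrow> bool" where
  "symbols_stored gs j m \<longleftrightarrow> m one = 1 \<and> m zero = 0 \<and> m base = sum_list (take j gs) + 1 \<and>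
     m nsym = length gs \<and> (\<forall>i<j. arr m syms (length gs - i) = gs ! i)"

text \<open>The postcondition also records that \<open>mark\<close>, \<open>watch\<close> and
  \<open>tos\<close> are still zero: marking relies on the zero initial memory in place of a pass
  that clears these arrays.\<close>

lemma read_symbols:
  "reaches (Seq init_symbols (Loop ctr read_symbol)) (\<lambda>_. 0, length gs # gs @ u, [])
     (5 + (13 * length gs + 1))
     (\<lambda>(m, u', v). symbols_stored gs (length gs) m \<and> u' = u \<and> v = [] \<and> m tos = 0 \<and>
        arr m mark = (\<lambda>_. 0) \<and> arr m watch = (\<lambda>_. 0))"
proof -
  let ?Inv = "\<lambda>j (m, u', v :: nat list). symbols_stored gs j m \<and> u' = drop j gs @ u \<and> v = [] \<and> m tos = 0 \<and>
        arr m mark = (\<lambda>_. 0) \<and> arr m watch = (\<lambda>_. 0)"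
  show ?thesis
  proof (rule reaches_Seq[of _ _ _ "\<lambda>c. ?Inv 0 c \<and> fst c ctr = length gs"])
    show "reaches init_symbols (\<lambda>_. 0, length gs # gs @ u, []) 5
        (\<lambda>c. ?Inv 0 c \<and> fst c ctr = length gs)"
      by (rule reaches_loop_free)
        (simp_all add: init_symbols_def symbols_stored_def run_simps arr_def)
  next
    fix c assume c: "?Inv 0 c \<and> fst c ctr = length gs"
    have "reaches (Loop ctr read_symbol) c ((12 + 1) * length gs + 1) (?Inv (length gs))"
    proof (rule reaches_count[where Inv = ?Inv])
      fix j m u' v
      assume j: "j < length gs" and inv: "?Inv j (m, u', v)" and ctr: "m ctr = length gs - j"
      have "drop j gs = gs ! j # drop (Suc j) gs"
        using j by (simp add: Cons_nth_drop_Suc)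
      then show "reaches read_symbol (m, u', v) 12
          (\<lambda>c'. ?Inv (Suc j) c' \<and> fst c' ctr = length gs - Suc j)"
        using j inv ctr
        by (intro reaches_loop_free)
          (auto simp: read_symbol_def symbols_stored_def run_simps take_Suc_conv_app_nth less_Suc_eq)
    qed (use c in auto)
    then show "reaches (Loop ctr read_symbol) c (13 * length gs + 1)
        (\<lambda>(m, u', v). symbols_stored gs (length gs) m \<and> u' = u \<and> v = [] \<and> m tos = 0 \<and>
          arr m mark = (\<lambda>_. 0) \<and> arr m watch = (\<lambda>_. 0))"
      by (rule reaches_mono) auto
  qed
qed

text \<open>The entry of \<open>repr\<close> for an action is the number of a rule with that action, so that
  distinct actions have distinct entries.\<close>

definition rules_stored :: "nat list \<Rightarrow> (nat, nat) rule list \<Rightarrow> nat \<Rightarrow> (nat \<Rightarrow> nat) \<Rightarrow> bool" where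
  "rules_stored gs rs j m \<longleftrightarrow> symbols_stored gs (length gs) m \<and> m nrule = length rs \<and>
     (\<forall>i<j. arr m lhs (length rs - i) = fst (rs ! i) \<and>
        arr m act (length rs - i) = fst (snd (rs ! i)) \<and>
        arr m fsts (length rs - i) = first (fresh gs) (snd (snd (rs ! i))) \<and>
        arr m snds (length rs - i) = second (fresh gs) (snd (snd (rs ! i)))) \<and>
     (\<forall>i<j. \<exists>i'<j. arr m repr (fst (snd (rs ! i))) = length rs - i' \<and>
        fst (snd (rs ! i')) = fst (snd (rs ! i)))"

definition unmarked_state :: "nat list \<Rightarrow> nat \<Rightarrow> nat \<Rightarrow> (nat \<Rightarrow> nat) \<Rightarrow> bool" where
  "unmarked_state gs n j m \<longleftrightarrow> m tos = 0 \<and> arr m mark = (\<lambda>_. 0)(fresh gs := 1) \<and>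
     arr m watch = (\<lambda>_. 0) \<and> (\<forall>i<j. arr m nxt (n - i) = n - i - 1)"

lemma read_rule_step:
  assumes len: "length \<alpha> \<le> 2"
    and st: "rules_stored gs rs j m" "unmarked_state gs (length rs) j m"
    and j: "j < length rs" "rs ! j = (X, a, \<alpha>)" "m ctr = length rs - j"
  shows "reaches read_rule (m, X # a # length \<alpha> # \<alpha> @ u, v) 80
    (\<lambda>(m, u', v'). rules_stored gs rs (Suc j) m \<and> unmarked_state gs (length rs) (Suc j) m \<and>
       u' = u \<and> v' = v \<and> m ctr = length rs - Suc j)"
proof -
  have neq: "length rs - i \<noteq> length rs - j" if "i < j" for i
    using that j(1) by simp
  consider "\<alpha> = []" | Y where "\<alpha> = [Y]" | Y Z where "\<alpha> = [Y, Z]"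
    using len by (cases \<alpha> rule: remdups_adj.cases) auto
  \<comment> \<open>Symbolic execution for each of the three lengths; what follows argues about
    arrays only.\<close>
  then have *: "loop_free_ok read_rule (m, X # a # length \<alpha> # \<alpha> @ u, v) \<and>
    (case loop_free_run read_rule (m, X # a # length \<alpha> # \<alpha> @ u, v) of (m', u', v') \<Rightarrow>
       u' = u \<and> v' = v \<and> m' one = 1 \<and> m' zero = 0 \<and> m' base = m base \<and> m' nsym = m nsym \<and>
       m' nrule = m nrule \<and> m' tos = m tos \<and> m' ctr = length rs - Suc j \<and>
       arr m' syms = arr m syms \<and> arr m' mark = arr m mark \<and> arr m' watch = arr m watch \<and>
       arr m' lhs = (arr m lhs)(length rs - j := X) \<and>
       arr m' act = (arr m act)(length rs - j := a) \<and>
       arr m' fsts = (arr m fsts)(length rs - j := first (fresh gs) \<alpha>) \<and>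
       arr m' snds = (arr m snds)(length rs - j := second (fresh gs) \<alpha>) \<and>
       arr m' repr = (arr m repr)(a := length rs - j) \<and>
       arr m' nxt = (arr m nxt)(length rs - j := length rs - j - 1))"
    using st(1) j(3) by (cases, simp_all add: read_rule_def rules_stored_def symbols_stored_def
      run_simps first_def second_def fresh_def)
  have ok: "loop_free_ok read_rule (m, X # a # length \<alpha> # \<alpha> @ u, v)"
    using * by blast
  obtain m' where run: "loop_free_run read_rule (m, X # a # length \<alpha> # \<alpha> @ u, v) = (m', u, v)"
    and m': "m' one = 1" "m' zero = 0" "m' base = m base" "m' nsym = m nsym"
      "m' nrule = m nrule" "m' tos = m tos" "m' ctr = length rs - Suc j"
      "arr m' syms = arr m syms" "arr m' mark = arr m mark" "arr m' watch = arr m watch"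
      "arr m' lhs = (arr m lhs)(length rs - j := X)"
      "arr m' act = (arr m act)(length rs - j := a)"
      "arr m' fsts = (arr m fsts)(length rs - j := first (fresh gs) \<alpha>)"
      "arr m' snds = (arr m snds)(length rs - j := second (fresh gs) \<alpha>)"
      "arr m' repr = (arr m repr)(a := length rs - j)"
      "arr m' nxt = (arr m nxt)(length rs - j := length rs - j - 1)"
    using conjunct2[OF *] by (auto split: prod.splits)
  have "rules_stored gs rs (Suc j) m'"
    unfolding rules_stored_def
  proof (intro conjI)
    show "symbols_stored gs (length gs) m'" "m' nrule = length rs"
      using st(1) m' by (simp_all add: rules_stored_def symbols_stored_def)
    show "\<forall>i<Suc j. arr m' lhs (length rs - i) = fst (rs ! i) \<and>
        arr m' act (length rs - i) = fst (snd (rs ! i)) \<and>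
        arr m' fsts (length rs - i) = first (fresh gs) (snd (snd (rs ! i))) \<and>
        arr m' snds (length rs - i) = second (fresh gs) (snd (snd (rs ! i)))"
      using st(1) neq j(2) by (simp add: rules_stored_def m' less_Suc_eq)
    show "\<forall>i<Suc j. \<exists>i'<Suc j. arr m' repr (fst (snd (rs ! i))) = length rs - i' \<and>
        fst (snd (rs ! i')) = fst (snd (rs ! i))"
    proof (intro allI impI)
      fix i assume "i < Suc j"
      show "\<exists>i'<Suc j. arr m' repr (fst (snd (rs ! i))) = length rs - i' \<and>
        fst (snd (rs ! i')) = fst (snd (rs ! i))"
      proof (cases "fst (snd (rs ! i)) = a")
        case True
        then show ?thesis using j(2) m' by (intro exI[of _ j]) simp
      next
        case False
        then have "i < j"
          using \<open>i < Suc j\<close> j(2) by (cases "i = j") auto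
        then show ?thesis
          using st(1) False m' unfolding rules_stored_def by (metis fun_upd_other less_Suc_eq)
      qed
    qed
  qed
  moreover have "unmarked_state gs (length rs) (Suc j) m'"
    using st(2) neq by (simp add: unmarked_state_def m' less_Suc_eq)
  ultimately show ?thesis
    using m'(7) ok run by (intro reaches_loop_free)
      (simp_all add: read_rule_def run_simps)
qed

lemma read_rules:
  assumes len: "\<And>X a \<alpha>. (X, a, \<alpha>) \<in> set rs \<Longrightarrow> length \<alpha> \<le> 2"
    and m: "symbols_stored gs (length gs) m" "m tos = 0" "arr m mark = (\<lambda>_. 0)" "arr m watch = (\<lambda>_. 0)"
  shows "reaches (Seq init_rules (Loop ctr read_rule))
    (m, length rs # concat (map encode_rule rs) @ u, v) (11 + (81 * length rs + 1))
    (\<lambda>(m, u', v'). rules_stored gs rs (length rs) m \<and> unmarked_state gs (length rs) (length rs) m \<and>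
       u' = u \<and> v' = v)"
proof -
  let ?Inv = "\<lambda>j (m, u', v'). rules_stored gs rs j m \<and> unmarked_state gs (length rs) j m \<and>
     u' = concat (map encode_rule (drop j rs)) @ u \<and> v' = v"
  show ?thesis
  proof (rule reaches_Seq[of _ _ _ "\<lambda>c. ?Inv 0 c \<and> fst c ctr = length rs"])
    show "reaches init_rules (m, length rs # concat (map encode_rule rs) @ u, v) 11
        (\<lambda>c. ?Inv 0 c \<and> fst c ctr = length rs)"
      using m by (intro reaches_loop_free)
        (simp_all add: init_rules_def rules_stored_def symbols_stored_def unmarked_state_def fresh_def
          run_simps)
  next
    fix c assume c: "?Inv 0 c \<and> fst c ctr = length rs"
    have "reaches (Loop ctr read_rule) c ((80 + 1) * length rs + 1) (?Inv (length rs))"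
    proof (rule reaches_count[where Inv = ?Inv])
      fix j m u' v'
      assume j: "j < length rs" and inv: "?Inv j (m, u', v')" and ctr: "m ctr = length rs - j"
      obtain X a \<alpha> where r: "rs ! j = (X, a, \<alpha>)"
        by (cases "rs ! j")
      have "drop j rs = rs ! j # drop (Suc j) rs"
        using j by (simp add: Cons_nth_drop_Suc)
      then have u': "u' = X # a # length \<alpha> # \<alpha> @ concat (map encode_rule (drop (Suc j) rs)) @ u"
        using inv r by (simp add: encode_list_def)
      have "length \<alpha> \<le> 2"
        using len r j nth_mem by metis
      then have "reaches read_rule (m, u', v') 80
        (\<lambda>(m, u'', v''). rules_stored gs rs (Suc j) m \<and> unmarked_state gs (length rs) (Suc j) m \<and>
           u'' = concat (map encode_rule (drop (Suc j) rs)) @ u \<and> v'' = v' \<and>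
           m ctr = length rs - Suc j)"
        unfolding u' using inv j r ctr by (intro read_rule_step) auto
      then show "reaches read_rule (m, u', v') 80 (\<lambda>c'. ?Inv (Suc j) c' \<and> fst c' ctr = length rs - Suc j)"
        by (rule reaches_mono) (use inv in auto)
    qed (use c in auto)
    then show "reaches (Loop ctr read_rule) c (81 * length rs + 1)
      (\<lambda>(m, u', v'). rules_stored gs rs (length rs) m \<and> unmarked_state gs (length rs) (length rs) m \<and>
         u' = u \<and> v' = v)"
      by (rule reaches_mono) auto
  qed
qed

section \<open>Correctness of the marking phase\<close>

definition kept :: "(nat \<Rightarrow> nat) \<Rightarrow> (nat \<Rightarrow> nat) \<Rightarrow> bool" where
  "kept m m' \<longleftrightarrow> m' one = m one \<and> m' zero = m zero \<and> m' base = m base \<and> m' nsym = m nsym \<and>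
     m' nrule = m nrule \<and> arr m' syms = arr m syms \<and> arr m' lhs = arr m lhs \<and> arr m' act = arr m act \<and>
     arr m' fsts = arr m fsts \<and> arr m' snds = arr m snds \<and> arr m' repr = arr m repr"

lemma kept_trans: "kept m m' \<Longrightarrow> kept m' m'' \<Longrightarrow> kept m m''"
  by (simp add: kept_def)

lemma kept_rules_stored: "kept m m' \<Longrightarrow> rules_stored gs rs j m \<Longrightarrow> rules_stored gs rs j m'"
  by (simp add: kept_def rules_stored_def symbols_stored_def)

context marking
begin

text \<open>Every rule number has one position, so the pending list and all watch lists are disjoint
  and can share the array \<open>nxt\<close>.\<close>

definition marking_state :: "(nat \<Rightarrow> nat) \<Rightarrow> (nat \<Rightarrow> position) \<Rightarrow> nat set \<Rightarrow> bool" where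
  "marking_state m pos Q \<longleftrightarrow> m one = 1 \<and> m zero = 0 \<and>
     arr m lhs = L \<and> arr m fsts = A \<and> arr m snds = B \<and> m rg = m cur + m tos \<and>
     linked (arr m nxt) (m cur) {k \<in> {1..n}. pos k = Pending} \<and>
     (\<forall>y. linked (arr m nxt) (arr m watch y) {k \<in> {1..n}. pos k = Watching y}) \<and>
     linked (arr m link) (m tos) Q \<and> invariant {y. arr m mark y \<noteq> 0} pos Q"

text \<open>Separates code from data: symbolic execution only has to yield an instance of
  \<open>updated\<close>, and the lemmas on \<open>marking_result\<close> justify each outcome
  without the program.\<close>

definition updated :: "(nat \<Rightarrow> nat) \<Rightarrow> ram_config \<Rightarrow> nat list \<Rightarrow> nat list \<Rightarrow> nat \<Rightarrow> nat \<Rightarrow>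
    (nat \<Rightarrow> nat) \<Rightarrow> (nat \<Rightarrow> nat) \<Rightarrow> (nat \<Rightarrow> nat) \<Rightarrow> (nat \<Rightarrow> nat) \<Rightarrow> bool" where
  "updated m c u v cu to ne wa li ma \<longleftrightarrow> (case c of (m', u', v') \<Rightarrow> u' = u \<and> v' = v \<and> kept m m' \<and>
     m' rg = cu + to \<and> m' cur = cu \<and> m' tos = to \<and>
     arr m' nxt = ne \<and> arr m' watch = wa \<and> arr m' link = li \<and> arr m' mark = ma)"

abbreviation marking_result :: "(nat \<Rightarrow> nat) \<Rightarrow> nat list \<Rightarrow> nat list \<Rightarrow> nat \<Rightarrow> ram_config \<Rightarrow> bool" where
  "marking_result m u v d \<equiv> \<lambda>(m', u', v'). u' = u \<and> v' = v \<and> kept m m' \<and>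
     (\<exists>pos Q. potential {y. arr m' mark y \<noteq> 0} pos Q < d \<and> marking_state m' pos Q)"

lemma marking_result_watch:
  assumes st: "marking_state m pos Q" and k: "m cur = k" "k \<noteq> 0"
    and y: "y = A k \<or> y = B k" "arr m mark y = 0"
    and upd: "updated m c u v (arr m nxt k) (m tos) ((arr m nxt)(k := arr m watch y))
      ((arr m watch)(y := k)) (arr m link) (arr m mark)"
  shows "marking_result m u v (potential {y. arr m mark y \<noteq> 0} pos Q) c"
proof -
  let ?M = "{y. arr m mark y \<noteq> 0}" and ?pos = "pos(k := Watching y)"
  obtain m' u' v' where c: "c = (m', u', v')" by (cases c)
  have P: "linked (arr m nxt) k {k \<in> {1..n}. pos k = Pending}"
    using st k by (simp add: marking_state_def)
  have kn: "k \<in> {1..n}" "pos k = Pending"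
    using linked_pop(1)[OF P k(2)] by auto
  have inv: "invariant ?M pos Q"
    using st by (simp add: marking_state_def)
  have 1: "{j \<in> {1..n}. ?pos j = Pending} = {k \<in> {1..n}. pos k = Pending} - {k}"
    by auto
  have 2: "{j \<in> {1..n}. ?pos j = Watching y'} =
      (if y' = y then insert k {k \<in> {1..n}. pos k = Watching y} else {k \<in> {1..n}. pos k = Watching y'})" for y'
    using kn by auto
  have "linked ((arr m nxt)(k := arr m watch y)) (arr m nxt k) {j \<in> {1..n}. ?pos j = Pending}"
    unfolding 1 using linked_pop(2)[OF P k(2)] by (rule linked_upd) simp
  \<comment> \<open>For \<open>y\<close> the write to \<open>nxt\<close> is the push of
    \<open>k\<close>; for any other symbol it hits a rule outside its list, because \<open>k\<close>
    was pending.\<close>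
  moreover have "linked ((arr m nxt)(k := arr m watch y)) (((arr m watch)(y := k)) y')
      {j \<in> {1..n}. ?pos j = Watching y'}" for y'
    unfolding 2 using st kn(2) k(2) by (auto simp: marking_state_def intro: linked_push linked_upd)
  ultimately have "marking_state m' ?pos Q"
    using st upd watch(1)[OF inv kn y(1)] y(2)
    by (simp add: c updated_def kept_def marking_state_def)
  then show ?thesis
    using upd watch(2)[OF inv kn y(1)] y(2) by (auto simp: c updated_def)
qed

lemma marking_result_marked:
  assumes st: "marking_state m pos Q" and k: "m cur = k" "k \<noteq> 0" and y: "arr m mark (L k) \<noteq> 0"
    and upd: "updated m c u v (arr m nxt k) (m tos) (arr m nxt) (arr m watch) (arr m link) (arr m mark)"
  shows "marking_result m u v (potential {y. arr m mark y \<noteq> 0} pos Q) c"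
proof -
  let ?M = "{y. arr m mark y \<noteq> 0}" and ?pos = "pos(k := Done)"
  obtain m' u' v' where c: "c = (m', u', v')" by (cases c)
  have P: "linked (arr m nxt) k {k \<in> {1..n}. pos k = Pending}"
    using st k by (simp add: marking_state_def)
  have kn: "k \<in> {1..n}" "pos k = Pending"
    using linked_pop(1)[OF P k(2)] by auto
  have inv: "invariant ?M pos Q"
    using st by (simp add: marking_state_def)
  have 1: "{j \<in> {1..n}. ?pos j = Pending} = {k \<in> {1..n}. pos k = Pending} - {k}"
    by auto
  have 2: "{j \<in> {1..n}. ?pos j = Watching y'} = {k \<in> {1..n}. pos k = Watching y'}" for y'
    using kn by auto
  have "marking_state m' ?pos Q"
    unfolding marking_state_def 1 2
    using st upd finish_marked(1)[OF inv kn] y linked_pop(2)[OF P k(2)]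
    by (simp add: c updated_def kept_def marking_state_def)
  then show ?thesis
    using upd finish_marked(2)[OF inv kn] y by (auto simp: c updated_def)
qed

lemma marking_result_unmarked:
  assumes st: "marking_state m pos Q" and k: "m cur = k" "k \<noteq> 0"
    and AB: "arr m mark (A k) \<noteq> 0" "arr m mark (B k) \<noteq> 0" and y: "arr m mark (L k) = 0"
    and upd: "updated m c u v (arr m nxt k) (Suc (L k)) (arr m nxt) (arr m watch)
      ((arr m link)(Suc (L k) := m tos)) ((arr m mark)(L k := 1))"
  shows "marking_result m u v (potential {y. arr m mark y \<noteq> 0} pos Q) c"
proof -
  let ?M = "{y. arr m mark y \<noteq> 0}" and ?pos = "pos(k := Done)"
  obtain m' u' v' where c: "c = (m', u', v')" by (cases c)
  have P: "linked (arr m nxt) k {k \<in> {1..n}. pos k = Pending}"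
    using st k by (simp add: marking_state_def)
  have kn: "k \<in> {1..n}" "pos k = Pending"
    using linked_pop(1)[OF P k(2)] by auto
  have inv: "invariant ?M pos Q"
    using st by (simp add: marking_state_def)
  have 1: "{j \<in> {1..n}. ?pos j = Pending} = {k \<in> {1..n}. pos k = Pending} - {k}"
    by auto
  have 2: "{j \<in> {1..n}. ?pos j = Watching y'} = {k \<in> {1..n}. pos k = Watching y'}" for y'
    using kn by auto
  have M': "{y. arr m' mark y \<noteq> 0} = insert (L k) ?M"
    using upd by (auto simp: c updated_def)
  have frame: "u' = u" "v' = v" "kept m m'"
    using upd by (simp_all add: c updated_def)
  \<comment> \<open>\<open>Q\<close> holds successors of marked symbols only, so no symbol is pushed
    while it is already on the stack.\<close>
  have "Suc (L k) \<notin> Q"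
    using inv y by (auto simp: invariant_def)
  then have "linked ((arr m link)(Suc (L k) := m tos)) (Suc (L k)) (insert (Suc (L k)) Q)"
    using st by (auto simp: marking_state_def intro: linked_push)
  then have "marking_state m' ?pos (insert (Suc (L k)) Q)"
    unfolding marking_state_def 1 2 M'
    using st upd finish_unmarked(1)[OF inv kn] AB y linked_pop(2)[OF P k(2)]
    by (simp add: c updated_def kept_def marking_state_def)
  moreover have "potential {y. arr m' mark y \<noteq> 0} ?pos (insert (Suc (L k)) Q) < potential ?M pos Q"
    unfolding M' using finish_unmarked(2)[OF inv kn] AB y by simp
  ultimately show ?thesis
    unfolding c using frame by blast
qed

lemma marking_result_release:
  assumes st: "marking_state m pos Q" and y: "m cur = 0" "m tos = Suc y"
    and upd: "updated m c u v (arr m watch y) (arr m link (Suc y)) (arr m nxt)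
      ((arr m watch)(y := 0)) (arr m link) (arr m mark)"
  shows "marking_result m u v (potential {y. arr m mark y \<noteq> 0} pos Q) c"
proof -
  let ?M = "{y. arr m mark y \<noteq> 0}" and ?pos = "release y pos"
  obtain m' u' v' where c: "c = (m', u', v')" by (cases c)
  have "linked (arr m link) (Suc y) Q"
    using st y by (simp add: marking_state_def)
  note Q = linked_pop[OF this, simplified]
  have inv: "invariant ?M pos Q"
    using st by (simp add: marking_state_def)
  have "{k \<in> {1..n}. pos k = Pending} = {}"
    using st y(1) linked_zero[of "arr m nxt"] unfolding marking_state_def by metis
  \<comment> \<open>As nothing was pending, the pending rules after the release are exactly those
    that waited for \<open>y\<close>.\<close>
  then have 1: "{j \<in> {1..n}. ?pos j = Pending} = {k \<in> {1..n}. pos k = Watching y}"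
    by (auto simp: release_def)
  have 2: "{j \<in> {1..n}. ?pos j = Watching y'} =
      (if y' = y then {} else {k \<in> {1..n}. pos k = Watching y'})" for y'
    by (auto simp: release_def)
  have "marking_state m' ?pos (Q - {Suc y})"
    unfolding marking_state_def 1 2
    using st upd release(1)[OF inv Q(1)] Q(2)
    by (simp add: c updated_def kept_def marking_state_def linked_Nil)
  then show ?thesis
    using upd release(2)[OF inv Q(1)] by (auto simp: c updated_def)
qed

lemma marking_step:
  assumes st: "marking_state m pos Q" and "m rg \<noteq> 0"
  shows "reaches marking_step (m, u, v) 90 (marking_result m u v (potential {y. arr m mark y \<noteq> 0} pos Q))"
proof (rule reaches_loop_free)
  have regs: "m one = 1" "m zero = 0" "arr m lhs = L" "arr m fsts = A" "arr m snds = B"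
    "m rg = m cur + m tos"
    using st by (auto simp: marking_state_def)
  note simps = marking_step_def attach_def run_simps regs updated_def kept_def
  show "marking_result m u v (potential {y. arr m mark y \<noteq> 0} pos Q)
      (loop_free_run marking_step (m, u, v))"
  proof (cases "m cur = 0")
    case True
    then obtain y where "m tos = Suc y"
      using assms(2) regs by (cases "m tos") auto
    with True show ?thesis
      by (intro marking_result_release[OF st]) (simp_all add: simps)
  next
    case cur: False
    consider "arr m mark (A (m cur)) = 0"
      | "arr m mark (A (m cur)) \<noteq> 0" "arr m mark (B (m cur)) = 0"
      | "arr m mark (A (m cur)) \<noteq> 0" "arr m mark (B (m cur)) \<noteq> 0" "arr m mark (L (m cur)) \<noteq> 0"
      | "arr m mark (A (m cur)) \<noteq> 0" "arr m mark (B (m cur)) \<noteq> 0" "arr m mark (L (m cur)) = 0"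
      by blast
    then show ?thesis
    proof cases
      case 1
      with cur show ?thesis
        by (intro marking_result_watch[OF st refl, of "A (m cur)"]) (simp_all add: simps)
    next
      case 2
      with cur show ?thesis
        by (intro marking_result_watch[OF st refl, of "B (m cur)"]) (simp_all add: simps)
    next
      case 3
      with cur show ?thesis
        by (intro marking_result_marked[OF st refl]) (simp_all add: simps)
    next
      case 4
      with cur show ?thesis
        by (intro marking_result_unmarked[OF st refl]) (simp_all add: simps)
    qed
  qed
  show "loop_free_ok marking_step (m, u, v)" "cost marking_step \<le> 90"
    by (simp_all add: marking_step_def attach_def run_simps)
qed

lemma marking_loop:
  assumes st: "marking_state m pos Q"
  shows "reaches (Loop rg marking_step) (m, u, v) (91 * potential {y. arr m mark y \<noteq> 0} pos Q + 1)
    (\<lambda>(m', u', v'). u' = u \<and> v' = v \<and> kept m m' \<and> {y. arr m' mark y \<noteq> 0} = derivable)"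
proof -
  let ?Inv = "\<lambda>d (m', u', v'). u' = u \<and> v' = v \<and> kept m m' \<and>
    (\<exists>pos Q. potential {y. arr m' mark y \<noteq> 0} pos Q = d \<and> marking_state m' pos Q)"
  have "reaches (Loop rg marking_step) (m, u, v) ((90 + 1) * potential {y. arr m mark y \<noteq> 0} pos Q + 1)
    (\<lambda>c. (\<exists>d. ?Inv d c) \<and> fst c rg = 0)"
  proof (rule reaches_Loop[of ?Inv])
    fix d c assume "?Inv d c" "fst c rg \<noteq> 0"
    then obtain m' pos Q where c: "c = (m', u, v)" "kept m m'" "m' rg \<noteq> 0"
      "potential {y. arr m' mark y \<noteq> 0} pos Q = d" "marking_state m' pos Q"
      by (cases c) auto
    have "reaches marking_step c 90 (marking_result m' u v d)"
      using marking_step[OF c(5,3)] c(1,4) by simp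
    then show "reaches marking_step c 90 (\<lambda>c'. \<exists>d' < d. ?Inv d' c')"
      by (rule reaches_mono) (use c(2) kept_trans in \<open>auto\<close>)
  qed (use st in \<open>auto simp: kept_def\<close>)
  then show ?thesis
  proof (rule reaches_mono)
    fix c assume *: "(\<exists>d. ?Inv d c) \<and> fst c rg = 0"
    then obtain m' pos Q where c: "c = (m', u, v)" "kept m m'" "m' rg = 0" "marking_state m' pos Q"
      by (cases c) auto
    \<comment> \<open>\<open>rg\<close> is the sum of the two list heads, so leaving the loop means
      that both lists are empty.\<close>
    have "m' cur = 0" "m' tos = 0"
      using c(3,4) by (simp_all add: marking_state_def)
    then have "Q = {}" "{k \<in> {1..n}. pos k = Pending} = {}"
      using c(4) linked_zero unfolding marking_state_def by metis+
    then have "{y. arr m' mark y \<noteq> 0} = derivable"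
      using c(4) invariant_final[of _ pos] by (auto simp: marking_state_def)
    then show "case c of (m', u', v') \<Rightarrow> u' = u \<and> v' = v \<and> kept m m' \<and> {y. arr m' mark y \<noteq> 0} = derivable"
      using c by simp
  qed simp
qed

end

text \<open>All rules start out pending, linked by their numbers. The initial potential is at most 6
  per rule and an iteration with its test takes at most 91 steps, whence 546 = 91 * 6.\<close>

lemma mark_symbols:
  fixes gs :: "nat list" and rs :: "(nat, nat) rule list"
  assumes m: "rules_stored gs rs (length rs) m" "unmarked_state gs (length rs) (length rs) m"
  shows "reaches (Seq init_marking (Loop rg marking_step)) (m, u, v) (3 + (546 * length rs + 1))
    (\<lambda>(m', u', v'). rules_stored gs rs (length rs) m' \<and> u' = u \<and> v' = v \<and>
       {y. arr m' mark y \<noteq> 0} =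
         marking.derivable (length rs) (fresh gs) (arr m' lhs) (arr m' fsts) (arr m' snds))"
proof -
  interpret marking "length rs" "fresh gs" "arr m lhs" "arr m fsts" "arr m snds" .
  let ?M = "{y. arr m mark y \<noteq> 0}"
  have regs: "m one = 1" "m zero = 0" "m nrule = length rs" "m tos = 0"
    "arr m mark = (\<lambda>_. 0)(fresh gs := 1)" "arr m watch = (\<lambda>_. 0)"
    using m by (auto simp: rules_stored_def symbols_stored_def unmarked_state_def)
  have nxt: "linked (arr m nxt) (length rs) {1..length rs}"
  proof (rule linked_down)
    fix k assume "0 < k" "k \<le> length rs"
    then have "arr m nxt (length rs - (length rs - k)) = length rs - (length rs - k) - 1"
      using m(2) unfolding unmarked_state_def by (metis diff_less less_le_trans)
    then show "arr m nxt k = k - 1"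
      using \<open>k \<le> length rs\<close> by simp
  qed
  have "invariant {y. ((\<lambda>_. 0 :: nat)(fresh gs := 1)) y \<noteq> 0} (\<lambda>_. Pending) {}"
    by (auto simp: invariant_def intro: derivable.base)
  then have inv: "invariant ?M (\<lambda>_. Pending) {}"
    unfolding regs .
  show ?thesis
  proof (rule reaches_Seq[of _ _ _ "\<lambda>(m', u', v'). u' = u \<and> v' = v \<and> kept m m' \<and>
      arr m' mark = arr m mark \<and> marking_state m' (\<lambda>_. Pending) {}"])
    show "reaches init_marking (m, u, v) 3 (\<lambda>(m', u', v'). u' = u \<and> v' = v \<and> kept m m' \<and>
      arr m' mark = arr m mark \<and> marking_state m' (\<lambda>_. Pending) {})"
      using nxt inv by (intro reaches_loop_free)
        (simp_all add: init_marking_def run_simps kept_def marking_state_def regs linked_Nil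
          atLeastAtMost_def atLeast_def atMost_def Int_def)
  next
    fix c assume "case c of (m', u', v') \<Rightarrow> u' = u \<and> v' = v \<and> kept m m' \<and>
      arr m' mark = arr m mark \<and> marking_state m' (\<lambda>_. Pending) {}"
    then obtain m' where c: "c = (m', u, v)" "kept m m'" "arr m' mark = arr m mark"
      "marking_state m' (\<lambda>_. Pending) {}"
      by (cases c) auto
    show "reaches (Loop rg marking_step) c (546 * length rs + 1)
      (\<lambda>(m', u', v'). rules_stored gs rs (length rs) m' \<and> u' = u \<and> v' = v \<and>
       {y. arr m' mark y \<noteq> 0} =
         marking.derivable (length rs) (fresh gs) (arr m' lhs) (arr m' fsts) (arr m' snds))"
      unfolding c(1)
    proof (rule reaches_mono[OF marking_loop[OF c(4)]])
      show "91 * potential {y. arr m' mark y \<noteq> 0} (\<lambda>_. Pending) {} + 1 \<le> 546 * length rs + 1"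
        using potential_initial[of ?M] by (simp add: c(3))
      show "case c' of (m', u', v') \<Rightarrow> rules_stored gs rs (length rs) m' \<and> u' = u \<and> v' = v \<and>
       {y. arr m' mark y \<noteq> 0} =
         marking.derivable (length rs) (fresh gs) (arr m' lhs) (arr m' fsts) (arr m' snds)"
        if "case c' of (m'', u', v') \<Rightarrow> u' = u \<and> v' = v \<and> kept m' m'' \<and>
          {y. arr m'' mark y \<noteq> 0} = derivable" for c'
      proof -
        obtain m'' where c': "c' = (m'', u, v)" "kept m' m''" "{y. arr m'' mark y \<noteq> 0} = derivable"
          using \<open>case c' of (m'', u', v') \<Rightarrow> _\<close> by (cases c') auto
        have "kept m m''"
          using kept_trans[OF c(2) c'(2)] .
        then show ?thesis
          using kept_rules_stored[OF _ m(1)] c' by (simp add: kept_def)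
      qed
    qed
  qed
qed

section \<open>Correctness of the output phase\<close>

definition rule_transitions ::
  "nat \<Rightarrow> (nat \<Rightarrow> nat) \<Rightarrow> nat set \<Rightarrow> (nat, nat) rule \<Rightarrow> nat \<Rightarrow> (nat \<times> nat \<times> nat) list" where
  "rule_transitions s f M r t = (case r of (X, a, \<alpha>) \<Rightarrow>
     [(X, f a, t), (t, 0, first s \<alpha>), (t, 1, if first s \<alpha> \<in> M then second s \<alpha> else s), (t, 1, s + 1)])"

definition transition_list ::
  "nat list \<Rightarrow> (nat, nat) rule list \<Rightarrow> (nat \<Rightarrow> nat) \<Rightarrow> nat set \<Rightarrow> nat \<Rightarrow> (nat \<times> nat \<times> nat) list" where
  "transition_list gs rs f M j = (let s = fresh gs in [(s, 2, s + 1), (s + 1, 2, s + 1)] @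
     concat (map (\<lambda>i. rule_transitions s f M (rs ! i) (s + 1 + (length rs - i))) [0..<j]))"

definition result_word :: "nat list \<Rightarrow> (nat, nat) rule list \<Rightarrow> (nat \<Rightarrow> nat) \<Rightarrow> nat set \<Rightarrow> nat list" where
  "result_word gs rs f M =
     encode_list (\<lambda>s. [s]) (gs @ [fresh gs..<fresh gs + (length rs + 2)]) @
     encode_list (\<lambda>a. [a]) [0..<length rs + 3] @
     encode_list (\<lambda>(s, a, s'). [s, a, s']) (transition_list gs rs f M (length rs))"

lemma length_transition_list: "length (transition_list gs rs f M j) = 4 * j + 2"
  by (induction j) (auto simp: transition_list_def Let_def rule_transitions_def split: prod.split)

abbreviation printing ::
  "nat list \<Rightarrow> (nat, nat) rule list \<Rightarrow> (nat \<Rightarrow> nat) \<Rightarrow> (nat \<Rightarrow> nat) \<Rightarrow> (nat \<Rightarrow> nat) \<Rightarrow> bool" where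
  "printing gs rs R K m \<equiv> rules_stored gs rs (length rs) m \<and> m rz = 2 \<and> arr m repr = R \<and> arr m mark = K"

lemma print_symbols:
  assumes "rules_stored gs rs (length rs) m"
  shows "reaches (Seq init_print_symbols (Loop ctr print_symbol)) (m, u, v) (6 + (12 * length gs + 1))
    (\<lambda>(m', u', v'). printing gs rs (arr m repr) (arr m mark) m' \<and> u' = u \<and>
       v' = v @ [length gs + length rs + 2] @ gs)"
proof -
  let ?Inv = "\<lambda>j (m', u', v'). printing gs rs (arr m repr) (arr m mark) m' \<and> u' = u \<and>
     v' = v @ [length gs + length rs + 2] @ take j gs"
  show ?thesis
  proof (rule reaches_Seq[of _ _ _ "\<lambda>c. ?Inv 0 c \<and> fst c ctr = length gs"])
    show "reaches init_print_symbols (m, u, v) 6 (\<lambda>c. ?Inv 0 c \<and> fst c ctr = length gs)"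
      using assms by (intro reaches_loop_free)
        (simp_all add: init_print_symbols_def rules_stored_def symbols_stored_def run_simps)
  next
    fix c assume c: "?Inv 0 c \<and> fst c ctr = length gs"
    have "reaches (Loop ctr print_symbol) c ((11 + 1) * length gs + 1) (?Inv (length gs))"
    proof (rule reaches_count[where Inv = ?Inv])
      fix j m' u' v'
      assume "j < length gs" "?Inv j (m', u', v')" "m' ctr = length gs - j"
      then show "reaches print_symbol (m', u', v') 11
          (\<lambda>c'. ?Inv (Suc j) c' \<and> fst c' ctr = length gs - Suc j)"
        by (intro reaches_loop_free) (auto simp: print_symbol_def rules_stored_def
          symbols_stored_def run_simps take_Suc_conv_app_nth)
    qed (use c in auto)
    then show "reaches (Loop ctr print_symbol) c (12 * length gs + 1)
      (\<lambda>(m', u', v'). printing gs rs (arr m repr) (arr m mark) m' \<and> u' = u \<and>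
       v' = v @ [length gs + length rs + 2] @ gs)"
      by (rule reaches_mono) auto
  qed
qed

lemma print_range:
  assumes "printing gs rs R K m" "m rx = a" "m ctr = N"
  shows "reaches (Loop ctr print_next) (m, u, v) (5 * N + 1)
    (\<lambda>(m', u', v'). printing gs rs R K m' \<and> u' = u \<and> v' = v @ [a..<a + N])"
proof -
  let ?Inv = "\<lambda>j (m', u', v'). printing gs rs R K m' \<and> u' = u \<and> v' = v @ [a..<a + j] \<and> m' rx = a + j"
  have "reaches (Loop ctr print_next) (m, u, v) ((4 + 1) * N + 1) (?Inv N)"
  proof (rule reaches_count[where Inv = ?Inv])
    fix j m' u' v'
    assume "j < N" "?Inv j (m', u', v')" "m' ctr = N - j"
    then show "reaches print_next (m', u', v') 4 (\<lambda>c'. ?Inv (Suc j) c' \<and> fst c' ctr = N - Suc j)"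
      by (intro reaches_loop_free) (auto simp: print_next_def rules_stored_def
        symbols_stored_def run_simps)
  qed (use assms in auto)
  then show ?thesis
    by (rule reaches_mono) auto
qed

lemma print_transitions:
  assumes m: "printing gs rs R K m"
  shows "reaches (Seq init_print_transitions (Loop ctr print_rule)) (m, u, v) (13 + (91 * length rs + 1))
    (\<lambda>(m', u', v'). u' = u \<and> v' = v @ encode_list (\<lambda>(s, a, s'). [s, a, s'])
       (transition_list gs rs (\<lambda>a. R a + 2) {y. K y \<noteq> 0} (length rs)))"
proof -
  let ?tr = "transition_list gs rs (\<lambda>a. R a + 2) {y. K y \<noteq> 0}"
  let ?Inv = "\<lambda>j (m', u', v'). printing gs rs R K m' \<and> m' ry = fresh gs + 1 \<and> u' = u \<and>
     v' = v @ [4 * length rs + 2] @ concat (map (\<lambda>(s, a, s'). [s, a, s']) (?tr j))"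
  show ?thesis
  proof (rule reaches_Seq[of _ _ _ "\<lambda>c. ?Inv 0 c \<and> fst c ctr = length rs"])
    show "reaches init_print_transitions (m, u, v) 13 (\<lambda>c. ?Inv 0 c \<and> fst c ctr = length rs)"
      using m by (intro reaches_loop_free)
        (auto simp: init_print_transitions_def rules_stored_def symbols_stored_def run_simps
          transition_list_def fresh_def)
  next
    fix c assume c: "?Inv 0 c \<and> fst c ctr = length rs"
    have "reaches (Loop ctr print_rule) c ((90 + 1) * length rs + 1) (?Inv (length rs))"
    proof (rule reaches_count[where Inv = ?Inv])
      fix j m' u' v'
      assume j: "j < length rs" "?Inv j (m', u', v')" "m' ctr = length rs - j"
      obtain X a \<alpha> where r: "rs ! j = (X, a, \<alpha>)"
        by (cases "rs ! j")
      have data: "arr m' lhs (length rs - j) = X" "arr m' act (length rs - j) = a"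
        "arr m' fsts (length rs - j) = first (fresh gs) \<alpha>"
        "arr m' snds (length rs - j) = second (fresh gs) \<alpha>"
        using j(1,2) r by (auto simp: rules_stored_def)
      have st: "rules_stored gs rs (length rs) m'" and regs: "m' one = 1" "m' zero = 0" "m' base = fresh gs"
          "m' ry = fresh gs + 1" "m' rz = 2" "arr m' repr = R" "arr m' mark = K" "u' = u"
          "v' = v @ [4 * length rs + 2] @ concat (map (\<lambda>(s, a, s'). [s, a, s']) (?tr j))"
        using j(2) by (auto simp: rules_stored_def symbols_stored_def fresh_def)
      show "reaches print_rule (m', u', v') 90 (\<lambda>c'. ?Inv (Suc j) c' \<and> fst c' ctr = length rs - Suc j)"
      proof (rule reaches_loop_free)
        have "case loop_free_run print_rule (m', u', v') of (m'', u'', v'') \<Rightarrow> kept m' m'' \<and>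
            m'' ry = m' ry \<and> m'' rz = m' rz \<and> arr m'' mark = K \<and> u'' = u \<and>
            v'' = v' @ concat (map (\<lambda>(s, a, s'). [s, a, s'])
              (rule_transitions (fresh gs) (\<lambda>a. R a + 2) {y. K y \<noteq> 0} (X, a, \<alpha>) (fresh gs + 1 + (length rs - j)))) \<and>
            m'' ctr = length rs - Suc j"
          using j(3) by (simp add: print_rule_def run_simps data regs kept_def rule_transitions_def)
        then show "?Inv (Suc j) (loop_free_run print_rule (m', u', v')) \<and>
            fst (loop_free_run print_rule (m', u', v')) ctr = length rs - Suc j"
          using kept_rules_stored[OF _ st] regs r
          by (auto simp: transition_list_def Let_def kept_def)
      qed (simp_all add: print_rule_def run_simps)
    qed (use c in auto)
    then show "reaches (Loop ctr print_rule) c (91 * length rs + 1)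
      (\<lambda>(m', u', v'). u' = u \<and> v' = v @ encode_list (\<lambda>(s, a, s'). [s, a, s']) (?tr (length rs)))"
      by (rule reaches_mono) (auto simp: encode_list_def length_transition_list)
  qed
qed

lemma print_fresh:
  assumes m: "printing gs rs R K m"
  shows "reaches (Seq init_print_fresh (Loop ctr print_next)) (m, u, v) (3 + (5 * (length rs + 2) + 1))
    (\<lambda>(m', u', v'). printing gs rs R K m' \<and> u' = u \<and> v' = v @ [fresh gs..<fresh gs + (length rs + 2)])"
proof (rule reaches_Seq[of _ _ _ "\<lambda>(m', u', v'). printing gs rs R K m' \<and> u' = u \<and> v' = v \<and>
    m' rx = fresh gs \<and> m' ctr = length rs + 2"])
  show "reaches init_print_fresh (m, u, v) 3 (\<lambda>(m', u', v'). printing gs rs R K m' \<and> u' = u \<and> v' = v \<and>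
    m' rx = fresh gs \<and> m' ctr = length rs + 2)"
    using m by (intro reaches_loop_free)
      (auto simp: init_print_fresh_def rules_stored_def symbols_stored_def run_simps fresh_def)
next
  fix c assume "case c of (m', u', v') \<Rightarrow> printing gs rs R K m' \<and> u' = u \<and> v' = v \<and>
    m' rx = fresh gs \<and> m' ctr = length rs + 2"
  then obtain m' where c: "c = (m', u, v)" "printing gs rs R K m'" "m' rx = fresh gs"
      "m' ctr = length rs + 2"
    by (cases c) auto
  show "reaches (Loop ctr print_next) c (5 * (length rs + 2) + 1)
    (\<lambda>(m', u', v'). printing gs rs R K m' \<and> u' = u \<and> v' = v @ [fresh gs..<fresh gs + (length rs + 2)])"
    unfolding c(1) by (rule print_range[OF c(2-4)])
qed

lemma concat_singletons: "concat (map (\<lambda>x. [x]) xs) = xs"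
  by (induction xs) auto

lemma print_labels:
  assumes m: "printing gs rs R K m"
  shows "reaches (Seq init_print_labels (Loop ctr print_next)) (m, u, v) (5 + (5 * (length rs + 3) + 1))
    (\<lambda>(m', u', v'). printing gs rs R K m' \<and> u' = u \<and>
      v' = v @ encode_list (\<lambda>a. [a]) [0..<length rs + 3])"
proof (rule reaches_Seq[of _ _ _ "\<lambda>(m', u', v'). printing gs rs R K m' \<and> u' = u \<and>
    v' = v @ [length rs + 3] \<and> m' rx = 0 \<and> m' ctr = length rs + 3"])
  show "reaches init_print_labels (m, u, v) 5 (\<lambda>(m', u', v'). printing gs rs R K m' \<and> u' = u \<and>
    v' = v @ [length rs + 3] \<and> m' rx = 0 \<and> m' ctr = length rs + 3)"
    using m by (intro reaches_loop_free)
      (auto simp: init_print_labels_def rules_stored_def symbols_stored_def run_simps)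
next
  fix c assume "case c of (m', u', v') \<Rightarrow> printing gs rs R K m' \<and> u' = u \<and>
    v' = v @ [length rs + 3] \<and> m' rx = 0 \<and> m' ctr = length rs + 3"
  then obtain m' where c: "c = (m', u, v @ [length rs + 3])" "printing gs rs R K m'" "m' rx = 0"
      "m' ctr = length rs + 3"
    by (cases c) auto
  show "reaches (Loop ctr print_next) c (5 * (length rs + 3) + 1)
    (\<lambda>(m', u', v'). printing gs rs R K m' \<and> u' = u \<and>
      v' = v @ encode_list (\<lambda>a. [a]) [0..<length rs + 3])"
    unfolding c(1) by (intro reaches_mono[OF print_range[OF c(2-4)]])
      (auto simp: encode_list_def concat_singletons)
qed

section \<open>The program as a whole\<close>

definition represents :: "(nat \<Rightarrow> nat) \<Rightarrow> (nat, nat) rule list \<Rightarrow> bool" where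
  "represents R rs \<longleftrightarrow> (\<forall>i < length rs. \<exists>i' < length rs.
     R (fst (snd (rs ! i))) = length rs - i' \<and> fst (snd (rs ! i')) = fst (snd (rs ! i)))"

text \<open>\<open>S\<close> plays the part of an empty body. Its absence from all right-hand sides
  ensures that padding is never mistaken for a genuine symbol.\<close>

lemma derivable_eq_normed:
  fixes rs :: "(nat, nat) rule list"
  assumes data: "\<And>i. i < length rs \<Longrightarrow> L (length rs - i) = fst (rs ! i) \<and>
      A (length rs - i) = first S (snd (snd (rs ! i))) \<and> B (length rs - i) = second S (snd (snd (rs ! i)))"
    and syms: "\<And>X a \<alpha>. (X, a, \<alpha>) \<in> set rs \<Longrightarrow> S \<notin> set \<alpha> \<and> length \<alpha> \<le> 2"
  shows "marking.derivable (length rs) S L A B = insert S (normed (set rs))"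
proof -
  interpret marking "length rs" S L A B .
  have "x \<in> insert S (normed (set rs))" if "x \<in> derivable" for x
    using that
  proof induction
    case (rule k)
    let ?i = "length rs - k"
    obtain X a \<alpha> where r: "rs ! ?i = (X, a, \<alpha>)"
      by (cases "rs ! ?i")
    have i: "?i < length rs" "length rs - ?i = k"
      using rule by auto
    then have mem: "(X, a, \<alpha>) \<in> set rs"
      using r nth_mem by metis
    have k: "L k = X" "A k = first S \<alpha>" "B k = second S \<alpha>"
      using data[OF i(1)] r i(2) by auto
    have "Y \<in> normed (set rs)" if Y: "Y \<in> set \<alpha>" for Y
    proof -
      consider "\<alpha> = [Y]" | Z where "\<alpha> = [Y, Z]" | Z where "\<alpha> = [Z, Y]"
        using Y syms[OF mem] by (cases \<alpha> rule: remdups_adj.cases) auto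
      then show ?thesis
        using rule.IH k syms[OF mem] by cases (auto simp: first_def second_def)
    qed
    then show ?case
      using normed.intros[OF mem] k by blast
  qed simp
  moreover have "x \<in> derivable" if "x \<in> normed (set rs)" for x
    using that
  proof induction
    case (1 X a \<alpha>)
    obtain i where i: "i < length rs" "rs ! i = (X, a, \<alpha>)"
      using 1(1) by (auto simp: in_set_conv_nth)
    have "first S \<alpha> \<in> derivable" "second S \<alpha> \<in> derivable"
      using 1 derivable.base by (auto simp: first_def second_def)
    then show ?case
      using derivable.rule[of "length rs - i"] data[OF i(1)] i by simp
  qed
  ultimately show ?thesis
    using derivable.base by blast
qed

definition prepared :: "nat list \<Rightarrow> (nat, nat) rule list \<Rightarrow> (nat \<Rightarrow> nat) \<Rightarrow> (nat \<Rightarrow> nat) \<Rightarrow> bool" where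
  "prepared gs rs R K \<longleftrightarrow> represents R rs \<and> {y. K y \<noteq> 0} = insert (fresh gs) (normed (set rs))"

text \<open>The phases sum to 25 steps per symbol, 728 per rule and 79 more; 800 dominates all
  three. The rest \<open>u\<close> of the input stays unread, so that a query may follow the encoded
  rules.\<close>

lemma program_correct:
  assumes rs: "\<And>X a \<alpha>. (X, a, \<alpha>) \<in> set rs \<Longrightarrow> set \<alpha> \<subseteq> set gs \<and> length \<alpha> \<le> 2"
  shows "reaches program
    (\<lambda>_. 0, encode_list (\<lambda>X. [X]) gs @ encode_list encode_rule rs @ u, [])
    (800 * (length gs + length rs + 1))
    (\<lambda>(m, u', v). u' = u \<and> (\<exists>R. represents R rs \<and>
       v = result_word gs rs (\<lambda>a. R a + 2) (insert (fresh gs) (normed (set rs)))))"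
proof -
  let ?n = "length rs" and ?w = "concat (map encode_rule rs)"
  let ?v1 = "encode_list (\<lambda>s. [s]) (gs @ [fresh gs..<fresh gs + (length rs + 2)])"
  let ?v2 = "encode_list (\<lambda>a. [a]) [0..<length rs + 3]"
  let ?P = "\<lambda>m. prepared gs rs (arr m repr) (arr m mark)"
  let ?pr = "\<lambda>m. rules_stored gs rs ?n m \<and> m rz = 2 \<and> ?P m"
  have fresh: "fresh gs \<notin> set gs"
    using member_le_sum_list by (fastforce simp: fresh_def)
  have word: "encode_list (\<lambda>X. [X]) gs @ encode_list encode_rule rs @ u = length gs # gs @ ?n # ?w @ u"
    by (simp add: encode_list_def concat_singletons)
  have 1: "reaches (Seq init_symbols (Loop ctr read_symbol)) (\<lambda>_. 0, length gs # gs @ ?n # ?w @ u, [])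
    (5 + (13 * length gs + 1))
    (\<lambda>(m, u', v). symbols_stored gs (length gs) m \<and> u' = ?n # ?w @ u \<and> v = [] \<and> m tos = 0 \<and>
        arr m mark = (\<lambda>_. 0) \<and> arr m watch = (\<lambda>_. 0))"
    by (rule read_symbols)
  have 2: "reaches (Seq init_rules (Loop ctr read_rule)) c (11 + (81 * ?n + 1))
    (\<lambda>(m, u', v'). rules_stored gs rs ?n m \<and> unmarked_state gs ?n ?n m \<and> u' = u \<and> v' = [])"
    if c: "case c of (m, u', v) \<Rightarrow> symbols_stored gs (length gs) m \<and> u' = ?n # ?w @ u \<and> v = [] \<and>
      m tos = 0 \<and> arr m mark = (\<lambda>_. 0) \<and> arr m watch = (\<lambda>_. 0)" for c
  proof -
    obtain m where m: "c = (m, ?n # ?w @ u, [])" "symbols_stored gs (length gs) m" "m tos = 0"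
      "arr m mark = (\<lambda>_. 0)" "arr m watch = (\<lambda>_. 0)"
      using c by (cases c) auto
    show ?thesis
      unfolding m(1) by (rule read_rules[OF _ m(2-5)]) (use rs in blast)
  qed
  have 3: "reaches (Seq init_marking (Loop rg marking_step)) c (3 + (546 * ?n + 1))
    (\<lambda>(m, u', v'). rules_stored gs rs ?n m \<and> ?P m \<and> u' = u \<and> v' = [])"
    if c: "case c of (m, u', v') \<Rightarrow> rules_stored gs rs ?n m \<and> unmarked_state gs ?n ?n m \<and> u' = u \<and> v' = []" for c
  proof -
    obtain m where m: "c = (m, u, [])" "rules_stored gs rs ?n m" "unmarked_state gs ?n ?n m"
      using c by (cases c) auto
    show ?thesis
      unfolding m(1)
    proof (rule reaches_mono[OF mark_symbols[OF m(2,3)]], simp)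
      fix c' assume "case c' of (m', u', v') \<Rightarrow> rules_stored gs rs ?n m' \<and> u' = u \<and> v' = [] \<and>
        {y. arr m' mark y \<noteq> 0} =
          marking.derivable ?n (fresh gs) (arr m' lhs) (arr m' fsts) (arr m' snds)"
      then obtain m' where c': "c' = (m', u, [])" "rules_stored gs rs ?n m'"
        "{y. arr m' mark y \<noteq> 0} = marking.derivable ?n (fresh gs) (arr m' lhs) (arr m' fsts) (arr m' snds)"
        by (cases c') auto
      have "marking.derivable ?n (fresh gs) (arr m' lhs) (arr m' fsts) (arr m' snds) =
          insert (fresh gs) (normed (set rs))"
        using c'(2) rs fresh by (intro derivable_eq_normed) (auto simp: rules_stored_def)
      then show "case c' of (m, u', v') \<Rightarrow> rules_stored gs rs ?n m \<and> ?P m \<and> u' = u \<and> v' = []"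
        using c' by (simp add: prepared_def represents_def rules_stored_def)
    qed
  qed
  have 4: "reaches (Seq init_print_symbols (Loop ctr print_symbol)) c (6 + (12 * length gs + 1))
    (\<lambda>(m, u', v'). ?pr m \<and> u' = u \<and> v' = (length gs + ?n + 2) # gs)"
    if c: "case c of (m, u', v') \<Rightarrow> rules_stored gs rs ?n m \<and> ?P m \<and> u' = u \<and> v' = []" for c
  proof -
    obtain m where m: "c = (m, u, [])" "rules_stored gs rs ?n m" "?P m"
      using c by (cases c) auto
    show ?thesis
      unfolding m(1) by (rule reaches_mono[OF print_symbols[OF m(2)]]) (use m(3) in auto)
  qed
  have 5: "reaches (Seq init_print_fresh (Loop ctr print_next)) c (3 + (5 * (?n + 2) + 1))
    (\<lambda>(m, u', v'). ?pr m \<and> u' = u \<and> v' = ?v1)"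
    if c: "case c of (m, u', v') \<Rightarrow> ?pr m \<and> u' = u \<and> v' = (length gs + ?n + 2) # gs" for c
  proof -
    obtain m where m: "c = (m, u, (length gs + ?n + 2) # gs)" "?pr m"
      using c by (cases c) auto
    from m have "printing gs rs (arr m repr) (arr m mark) m" by simp
    from print_fresh[OF this] show ?thesis
      unfolding m(1) by (rule reaches_mono)
        (use m(2) in \<open>auto simp: encode_list_def concat_singletons simp del: upt_Suc\<close>)
  qed
  have 6: "reaches (Seq init_print_labels (Loop ctr print_next)) c (5 + (5 * (?n + 3) + 1))
    (\<lambda>(m, u', v'). ?pr m \<and> u' = u \<and> v' = ?v1 @ ?v2)"
    if c: "case c of (m, u', v') \<Rightarrow> ?pr m \<and> u' = u \<and> v' = ?v1" for c
  proof -
    obtain m where m: "c = (m, u, ?v1)" "?pr m"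
      using c by (cases c) auto
    from m have "printing gs rs (arr m repr) (arr m mark) m" by simp
    from print_labels[OF this] show ?thesis
      unfolding m(1) by (rule reaches_mono) (use m(2) in \<open>auto simp del: upt_Suc\<close>)
  qed
  let ?Q = "\<lambda>(m, u', v). u' = u \<and> (\<exists>R. represents R rs \<and>
       v = result_word gs rs (\<lambda>a. R a + 2) (insert (fresh gs) (normed (set rs))))"
  have 7: "reaches (Seq init_print_transitions (Loop ctr print_rule)) c (13 + (91 * ?n + 1)) ?Q"
    if c: "case c of (m, u', v') \<Rightarrow> ?pr m \<and> u' = u \<and> v' = ?v1 @ ?v2" for c
  proof -
    obtain m where m: "c = (m, u, ?v1 @ ?v2)" "?pr m"
      using c by (cases c) auto
    from m have "printing gs rs (arr m repr) (arr m mark) m" by simp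
    from print_transitions[OF this] show ?thesis
      unfolding m(1)
    proof (rule reaches_mono)
      let ?v3 = "encode_list (\<lambda>(s, a, s'). [s, a, s'])
        (transition_list gs rs (\<lambda>a. arr m repr a + 2) {y. arr m mark y \<noteq> 0} ?n)"
      fix c' assume c': "case c' of (m', u', v') \<Rightarrow> u' = u \<and> v' = (?v1 @ ?v2) @ ?v3"
      obtain m' u' v' where "c' = (m', u', v')" by (cases c')
      moreover have "(?v1 @ ?v2) @ ?v3 =
          result_word gs rs (\<lambda>a. arr m repr a + 2) (insert (fresh gs) (normed (set rs)))"
        using m(2) by (simp only: prepared_def result_word_def append_assoc)
      ultimately show "?Q c'"
        using c' m(2) unfolding prepared_def by blast
    qed simp
  qed
  have 8: "reaches (block []) c 1 ?Q" if "?Q c" for c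
    using that by (intro reaches_loop_free) (cases c; simp)+
  note seq = reaches_Seq[OF 1 reaches_Seq[OF 2 reaches_Seq[OF 3 reaches_Seq[OF 4
    reaches_Seq[OF 5 reaches_Seq[OF 6 reaches_Seq[OF 7 8]]]]]]]
  show ?thesis
    unfolding word program_def block.simps(2)
    by (rule reaches_mono[OF seq]) auto
qed

section \<open>The reduction\<close>

text \<open>\<open>h\<close> recovers from an entry the block it belongs to, so different blocks are
  disjoint.\<close>

lemma distinct_concat_map:
  assumes "distinct xs" "\<And>x. x \<in> set xs \<Longrightarrow> distinct (g x)"
    and "\<And>x y. x \<in> set xs \<Longrightarrow> y \<in> set (g x) \<Longrightarrow> h y = x"
  shows "distinct (concat (map g xs))"
  using assms
proof (induction xs)
  case (Cons x xs)
  have "y \<notin> set (concat (map g xs))" if "y \<in> set (g x)" for y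
  proof
    assume "y \<in> set (concat (map g xs))"
    then obtain x' where "x' \<in> set xs" "y \<in> set (g x')" by auto
    then show False
      using Cons.prems(1) Cons.prems(3)[of x y] Cons.prems(3)[of x' y] that by auto
  qed
  moreover have "distinct (concat (map g xs))"
    using Cons.prems by (intro Cons.IH) auto
  ultimately show ?case
    using Cons.prems(2)[of x] by auto
qed simp

lemma result_encodes_lts:
  assumes vbpa: "vbpa Act\<^sub>c Act\<^sub>r Act\<^sub>i \<Gamma> \<Delta>" and gs: "enumerates gs \<Gamma>" and rs: "enumerates rs \<Delta>"
    and R: "represents R rs"
    and v: "v = result_word gs rs (\<lambda>a. R a + 2) (insert (fresh gs) (normed \<Delta>))"
  shows "\<exists>T. encodes_lts v T \<and> finite_lts T \<and> card (states T) = length gs + length rs + 2 \<and>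
    card (transitions T) = 4 * length rs + 2 \<and> \<Gamma> \<subseteq> states T \<and>
    (\<forall>b. \<forall>X \<in> \<Gamma>. \<forall>Y \<in> \<Gamma>. related b (vbpa_lts Act\<^sub>c Act\<^sub>r Act\<^sub>i \<Gamma> \<Delta>) [X] [Y] \<longleftrightarrow> related b T X Y)"
proof -
  let ?n = "length rs" and ?s = "fresh gs" and ?f = "\<lambda>a. R a + 2"
  define idx where "idx = the_inv_into {..<?n} ((!) rs)"
  \<comment> \<open>\<open>?n - idx r\<close> is the number that the program assigns to the rule;
    the offset places it above the two sinks.\<close>
  define st where "st r = ?s + 1 + (?n - idx r)" for r
  have set_gs: "set gs = \<Gamma>" "distinct gs" and set_rs: "set rs = \<Delta>" "distinct rs"
    using gs rs by (auto simp: enumerates_def)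
  have below: "X < ?s" if "X \<in> \<Gamma>" for X
    using member_le_sum_list[of X gs] that set_gs by (simp add: fresh_def)
  have inj: "inj_on ((!) rs) {..<?n}"
    using set_rs(2) by (simp add: inj_on_nth)
  have idx: "idx (rs ! i) = i" if "i < ?n" for i
    unfolding idx_def using inj that by (intro the_inv_into_f_f) auto
  have rule_ex: "\<exists>i < ?n. r = rs ! i" if "r \<in> \<Delta>" for r
    using that set_rs(1) by (metis in_set_conv_nth)
  have st_nth: "st (rs ! i) = ?s + 1 + (?n - i)" if "i < ?n" for i
    using idx[OF that] by (simp add: st_def)
  have st_range: "?s + 1 < st r \<and> st r < ?s + (?n + 2)" if "r \<in> \<Delta>" for r
    using rule_ex[OF that] st_nth by fastforce
  have st_inj: "inj_on st \<Delta>"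
  proof (rule inj_onI)
    fix r r' assume "r \<in> \<Delta>" "r' \<in> \<Delta>" "st r = st r'"
    then obtain i i' where "i < ?n" "r = rs ! i" "i' < ?n" "r' = rs ! i'"
      using rule_ex by blast
    moreover from this have "?n - i = ?n - i'"
      using \<open>st r = st r'\<close> st_nth[of i] st_nth[of i'] by (simp only: add_left_cancel)
    ultimately have "i = i'"
      by linarith
    then show "r = r'"
      using \<open>r = rs ! i\<close> \<open>r' = rs ! i'\<close> by simp
  qed
  have label: "\<exists>i < ?n. R a = ?n - i \<and> fst (snd (rs ! i)) = a" if "(X, a, \<alpha>) \<in> \<Delta>" for X a \<alpha>
    using rule_ex[OF that] R unfolding represents_def by (metis fst_conv snd_conv)
  have R_inj: "a = b" if ab: "(X, a, \<alpha>) \<in> \<Delta>" "(Y, b, \<beta>) \<in> \<Delta>" "?f a = ?f b" for X Y a b \<alpha> \<beta>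
  proof -
    obtain i i' where "i < ?n" "R a = ?n - i" "fst (snd (rs ! i)) = a"
      "i' < ?n" "R b = ?n - i'" "fst (snd (rs ! i')) = b"
      using label[OF ab(1)] label[OF ab(2)] by blast
    then show ?thesis
      using ab(3) by (metis add_right_cancel diff_diff_cancel less_imp_le_nat)
  qed
  have R_range: "0 < R a \<and> R a \<le> ?n" if "(X, a, \<alpha>) \<in> \<Delta>" for X a \<alpha>
    using label[OF that] by fastforce
  \<comment> \<open>Labels 0, 1 and 2 are taken by the auxiliary transitions. Representatives range
    over 1 to \<open>?n\<close>, so the shift by 2 puts the actions between 3 and
    \<open>?n + 2\<close>.\<close>
  interpret finite_state_reduction Act\<^sub>c Act\<^sub>r Act\<^sub>i \<Gamma> \<Delta> ?s "?s + 1" st ?f 0 1 2 "{0..<?n + 3}"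
  proof
    show "?s \<notin> \<Gamma>" "?s + 1 \<notin> \<Gamma>"
      using below by fastforce+
    show "st r \<notin> \<Gamma>" "st r \<noteq> ?s" "st r \<noteq> ?s + 1" if "r \<in> \<Delta>" for r
      using st_range[OF that] below by fastforce+
    show "?f a \<notin> {0, 1, 2}" "?f a \<in> {0..<?n + 3}" if "(X, a, \<alpha>) \<in> \<Delta>" for X a \<alpha>
      using R_range[OF that] by auto
    show "a = b" if "(X, a, \<alpha>) \<in> \<Delta>" "(Y, b, \<beta>) \<in> \<Delta>" "?f a = ?f b" for X Y a b \<alpha> \<beta>
      using R_inj[OF that] .
  qed (use vbpa st_inj in auto)
  let ?M = "insert ?s (normed \<Delta>)"
  let ?ss = "gs @ [?s..<?s + (?n + 2)]" and ?ts = "transition_list gs rs ?f ?M ?n"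
  define tr where "tr i = rule_transitions ?s ?f ?M (rs ! i) (?s + 1 + (?n - i))" for i
  have targets: "first ?s \<alpha> = left \<alpha>" "(if first ?s \<alpha> \<in> ?M then second ?s \<alpha> else ?s) = right \<alpha>"
    if "(X, a, \<alpha>) \<in> \<Delta>" for X a \<alpha>
  proof -
    show "first ?s \<alpha> = left \<alpha>"
      by (simp add: first_def left_def)
    \<comment> \<open>The program tests \<open>mark\<close>, which includes the fresh symbol; for a
      genuine first symbol this agrees with normedness.\<close>
    have "hd \<alpha> \<noteq> ?s" if "length \<alpha> = 2"
      using rule_symbols(2)[OF \<open>(X, a, \<alpha>) \<in> \<Delta>\<close>] that below[of ?s] by (cases \<alpha>) auto
    then show "(if first ?s \<alpha> \<in> ?M then second ?s \<alpha> else ?s) = right \<alpha>"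
      by (auto simp: first_def second_def right_def)
  qed
  have tr_eq: "tr i = (case rs ! i of (X, a, \<alpha>) \<Rightarrow> [(X, ?f a, st (X, a, \<alpha>)),
      (st (X, a, \<alpha>), 0, left \<alpha>), (st (X, a, \<alpha>), 1, right \<alpha>), (st (X, a, \<alpha>), 1, ?s + 1)])"
    if "i < ?n" for i
  proof -
    obtain X a \<alpha> where r: "rs ! i = (X, a, \<alpha>)" by (cases "rs ! i")
    then have "(X, a, \<alpha>) \<in> \<Delta>"
      using that set_rs(1) nth_mem by metis
    then show ?thesis
      using targets st_nth[OF that] r by (simp add: tr_def rule_transitions_def)
  qed
  have ts_eq: "?ts = [(?s, 2, ?s + 1), (?s + 1, 2, ?s + 1)] @ concat (map tr [0..<?n])"
    by (simp add: transition_list_def Let_def tr_def[abs_def])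
  have "set (concat (map tr [0..<?n])) = (\<Union>i \<in> {..<?n}. set (tr i))"
    by auto
  also have "\<dots> = (\<Union>r \<in> (!) rs ` {..<?n}. case r of (X, a, \<alpha>) \<Rightarrow> {(X, ?f a, st (X, a, \<alpha>)),
      (st (X, a, \<alpha>), 0, left \<alpha>), (st (X, a, \<alpha>), 1, right \<alpha>), (st (X, a, \<alpha>), 1, ?s + 1)})"
    unfolding image_image
    by (intro SUP_cong refl) (auto simp: tr_eq split: prod.split)
  also have "(!) rs ` {..<?n} = \<Delta>"
    using set_rs(1) by (auto simp: set_conv_nth)
  finally have set_ts: "set ?ts = transitions T"
    unfolding ts_eq T_def by simp
  have "distinct ?ts"
  proof -
    \<comment> \<open>Every transition of a rule touches its intermediate state, as target if the
      source is a symbol and as source otherwise, and that state identifies the rule.\<close>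
    define owner where "owner t = (case t of (s, a, s') \<Rightarrow> if s \<in> \<Gamma> then idx (inv_into \<Delta> st s')
      else idx (inv_into \<Delta> st s))" for t :: "nat \<times> nat \<times> nat"
    have rule: "\<exists>X a \<alpha>. rs ! i = (X, a, \<alpha>) \<and> (X, a, \<alpha>) \<in> \<Delta>" if "i < ?n" for i
      using that set_rs(1) nth_mem by (metis prod.exhaust)
    have "owner t = i" if "i < ?n" "t \<in> set (tr i)" for i t
    proof -
      obtain X a \<alpha> where r: "rs ! i = (X, a, \<alpha>)" "(X, a, \<alpha>) \<in> \<Delta>"
        using rule[OF \<open>i < ?n\<close>] by blast
      have "idx (inv_into \<Delta> st (st (X, a, \<alpha>))) = i"
        using inv_into_f_f[OF st_inj r(2)] idx[OF that(1)] r(1) by simp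
      then show ?thesis
        using that(2) rule_symbols(1)[OF r(2)] st_fresh(1)[OF r(2)]
        by (auto simp: tr_eq[OF that(1)] r(1) owner_def)
    qed
    moreover have "distinct (tr i)" if i: "i < ?n" for i
    proof -
      obtain X a \<alpha> where r: "rs ! i = (X, a, \<alpha>)" "(X, a, \<alpha>) \<in> \<Delta>"
        using rule[OF i] by blast
      \<comment> \<open>The two transitions with label 1 differ because
        \<open>right \<alpha>\<close> is \<open>E\<close> or a symbol, hence not
        \<open>F\<close>.\<close>
      then show ?thesis
        using rule_symbols(1)[OF r(2)] st_fresh(1)[OF r(2)] right_in[OF r(2)] F_notin
        by (auto simp: tr_eq[OF i])
    qed
    ultimately have "distinct (concat (map tr [0..<?n]))"
      by (intro distinct_concat_map[where h = owner]) auto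
    moreover have "(s, b, s') \<notin> set (tr i)" if i: "i < ?n" and s: "s \<in> {?s, ?s + 1}" for i s b s'
    proof -
      obtain X a \<alpha> where r: "rs ! i = (X, a, \<alpha>)" "(X, a, \<alpha>) \<in> \<Delta>"
        using rule[OF i] by blast
      then show ?thesis
        using rule_symbols(1)[OF r(2)] st_fresh[OF r(2)] E_notin F_notin s
        by (auto simp: tr_eq[OF i])
    qed
    ultimately show ?thesis
      unfolding ts_eq by auto
  qed
  moreover have "distinct ?ss"
    using set_gs below by fastforce
  moreover have "set ?ss = states T"
  proof -
    have "st ` \<Delta> = {?s + 2..<?s + (?n + 2)}"
    proof
      show "st ` \<Delta> \<subseteq> {?s + 2..<?s + (?n + 2)}"
        using st_range by fastforce
      show "{?s + 2..<?s + (?n + 2)} \<subseteq> st ` \<Delta>"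
      proof
        fix x assume x: "x \<in> {?s + 2..<?s + (?n + 2)}"
        let ?i = "?n - (x - ?s - 1)"
        have "?i < ?n" using x by auto
        then have "st (rs ! ?i) = x" "rs ! ?i \<in> \<Delta>"
          using st_nth[of ?i] x set_rs(1) by auto
        then show "x \<in> st ` \<Delta>" by (intro image_eqI[OF sym])
      qed
    qed
    moreover have "{?s..<?s + (?n + 2)} = {?s, ?s + 1} \<union> {?s + 2..<?s + (?n + 2)}"
      by auto
    ultimately show ?thesis
      unfolding T_states set_append set_gs(1) set_upt by blast
  qed
  ultimately have ss: "distinct ?ss" "set ?ss = states T" and ts: "distinct ?ts"
    by blast+
  have "enumerates ?ss (states T)" "enumerates ?ts (transitions T)"
    using ss ts set_ts unfolding enumerates_def by blast+
  moreover have "enumerates [0..<?n + 3] (actions T)"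
    unfolding enumerates_def T_def by simp
  ultimately have "encodes_lts v T"
    unfolding encodes_lts_def v result_word_def by blast
  moreover have "card (states T) = length gs + ?n + 2"
    using distinct_card[OF ss(1)] ss(2) by simp
  moreover have "card (transitions T) = 4 * ?n + 2"
    using distinct_card[OF ts] set_ts length_transition_list by metis
  ultimately show ?thesis
    using finite_lts_T related_preserved T_states by blast
qed

section \<open>Time and size bounds\<close>

lemma vbpa_rules:
  assumes "vbpa Act\<^sub>c Act\<^sub>r Act\<^sub>i \<Gamma> \<Delta>" "(X, a, \<alpha>) \<in> \<Delta>"
  shows "set \<alpha> \<subseteq> \<Gamma> \<and> length \<alpha> \<le> 2"
  using assms unfolding vbpa_def by (elim conjE) (drule (1) bspec, auto)

lemma program_correct_vbpa:
  assumes "vbpa Act\<^sub>c Act\<^sub>r Act\<^sub>i \<Gamma> \<Delta>" "enumerates gs \<Gamma>" "enumerates rs \<Delta>"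
  shows "reaches program (\<lambda>_. 0, encode_list (\<lambda>X. [X]) gs @ encode_list encode_rule rs @ u, [])
    (800 * (length gs + length rs + 1))
    (\<lambda>(m, u', v). u' = u \<and> (\<exists>R. represents R rs \<and>
       v = result_word gs rs (\<lambda>a. R a + 2) (insert (fresh gs) (normed \<Delta>))))"
proof -
  have sets: "\<Gamma> = set gs" "\<Delta> = set rs"
    using assms(2,3) by (auto simp: enumerates_def)
  show ?thesis
    using vbpa_rules[OF assms(1)] unfolding sets by (rule program_correct)
qed

lemma linearly_bounded_affine: "linearly_bounded (\<lambda>n. a * n + b)"
  unfolding linearly_bounded_def
proof (rule bigoI[where c = "real (a + b)"])
  have "real (a * n + b) \<le> real (a + b) * real n" if "n \<ge> 1" for n
  proof -
    have "a * n + b \<le> (a + b) * n"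
      using that by (simp add: distrib_right)
    then show ?thesis
      by (metis of_nat_mono of_nat_mult)
  qed
  then show "\<forall>\<^sub>F n in sequentially. norm (real (a * n + b)) \<le> real (a + b) * norm (real n)"
    unfolding eventually_sequentially by (intro exI[of _ 1]) auto
qed

lemma length_rules_le_size:
  assumes "enumerates rs \<Delta>"
  shows "length rs \<le> rules_size \<Delta>"
proof -
  have "finite \<Delta>" "length rs = card \<Delta>"
    using assms distinct_card[of rs] by (auto simp: enumerates_def)
  moreover have "(\<Sum>r \<in> \<Delta>. 1) \<le> rules_size \<Delta>"
    unfolding rules_size_def by (intro sum_mono) auto
  ultimately show ?thesis by simp
qed

text \<open>A rule mentions at most \<open>1 + length \<alpha>\<close> symbols. Here the occurrence
  of every symbol in some rule turns a bound in symbols and rules into one in the size of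
  \<open>\<Delta>\<close>.\<close>

lemma length_symbols_le_size:
  assumes gs: "enumerates gs \<Gamma>" and rs: "enumerates rs \<Delta>" and used: "all_symbols_used \<Gamma> \<Delta>"
  shows "length gs \<le> rules_size \<Delta>"
proof -
  let ?S = "\<lambda>(X, a, \<alpha>). insert X (set \<alpha>)"
  have fin: "finite \<Delta>"
    using rs by (auto simp: enumerates_def)
  have "\<Gamma> \<subseteq> (\<Union>r \<in> \<Delta>. ?S r)"
    using used unfolding all_symbols_used_def by fastforce
  then have "card \<Gamma> \<le> card (\<Union>r \<in> \<Delta>. ?S r)"
    using fin by (intro card_mono) auto
  also have "\<dots> \<le> (\<Sum>r \<in> \<Delta>. card (?S r))"
    using fin by (rule card_UN_le)
  also have "\<dots> \<le> rules_size \<Delta>"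
    unfolding rules_size_def
  proof (rule sum_mono)
    fix r assume "r \<in> \<Delta>"
    obtain X a \<alpha> where r: "r = (X, a, \<alpha>)" by (cases r)
    have "card (insert X (set \<alpha>)) \<le> Suc (card (set \<alpha>))"
      by (simp add: card_insert_if)
    also have "\<dots> \<le> 2 + length \<alpha>"
      using card_length[of \<alpha>] by simp
    finally show "card (?S r) \<le> (case r of (X, a, \<alpha>) \<Rightarrow> 2 + length \<alpha>)"
      by (simp add: r)
  qed
  finally show ?thesis
    using gs distinct_card[of gs] by (auto simp: enumerates_def)
qed

section \<open>Unique decoding and the reduction between decision problems\<close>

text \<open>The header fixes the number of entries, and each entry can be split off from any
  continuation.\<close>

lemma encode_list_cancel:
  assumes f: "\<And>x y u v. f x @ u = f y @ v \<Longrightarrow> x = y \<and> u = v"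
    and eq: "encode_list f xs @ u = encode_list f ys @ v"
  shows "xs = ys \<and> u = v"
proof -
  have "length xs = length ys" "concat (map f xs) @ u = concat (map f ys) @ v"
    using eq by (auto simp: encode_list_def)
  then show ?thesis
  proof (induction xs ys rule: list_induct2)
    case (Cons x xs y ys)
    then show ?case
      using f[of x "concat (map f xs) @ u" y "concat (map f ys) @ v"] by simp
  qed simp
qed

lemma encode_vbpa_cancel:
  assumes "encode_list (\<lambda>X. [X]) gs @ encode_list encode_rule rs @ u =
    encode_list (\<lambda>X. [X]) gs' @ encode_list encode_rule rs' @ u'"
  shows "gs = gs' \<and> rs = rs' \<and> u = (u' :: nat list)"
proof -
  have "gs = gs' \<and> encode_list encode_rule rs @ u = encode_list encode_rule rs' @ u'"
    using assms by (intro encode_list_cancel[of "\<lambda>X. [X]"]) auto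
  moreover have "r = r' \<and> u = u'" if eq: "encode_rule r @ u = encode_rule r' @ u'" for r r' u u'
  proof -
    obtain X a \<alpha> X' a' \<alpha>' where r: "r = (X, a, \<alpha>)" "r' = (X', a', \<alpha>')"
      by (cases r, cases r')
    then have "X = X'" "a = a'" "encode_list (\<lambda>Y. [Y]) \<alpha> @ u = encode_list (\<lambda>Y. [Y]) \<alpha>' @ u'"
      using eq by auto
    moreover from this(3) have "\<alpha> = \<alpha>' \<and> u = u'"
      by (intro encode_list_cancel[of "\<lambda>Y. [Y]"]) auto
    ultimately show ?thesis
      using r by simp
  qed
  then have "rs = rs' \<and> u = u'"
    using calculation by (intro encode_list_cancel[of encode_rule]) blast+
  ultimately show ?thesis by blast
qed

lemma length_encoded_vbpa:
  "length gs + length rs + 2 \<le> length (encode_list (\<lambda>X. [X]) gs @ encode_list encode_rule rs)"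
proof -
  have "length rs \<le> length (concat (map encode_rule rs))"
    by (induction rs) auto
  then show ?thesis
    by (simp add: encode_list_def concat_singletons)
qed

theorem vbpa_translation:
  "\<exists>(p :: ram) time_bound state_bound transition_bound.
      linearly_bounded time_bound \<and> linearly_bounded state_bound \<and> linearly_bounded transition_bound \<and>
      (\<forall>(Act\<^sub>c :: nat set) Act\<^sub>r Act\<^sub>i (\<Gamma> :: nat set) \<Delta> w.
         vbpa Act\<^sub>c Act\<^sub>r Act\<^sub>i \<Gamma> \<Delta> \<and> all_symbols_used \<Gamma> \<Delta> \<and> encodes_vbpa w \<Gamma> \<Delta> \<longrightarrow>
         (\<exists>(T :: (nat, nat) lts) v n.
            outputs_in p w v n \<and> n \<le> time_bound (rules_size \<Delta>) \<and>
            encodes_lts v T \<and> finite_lts T \<and>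
            card (states T) \<le> state_bound (rules_size \<Delta>) \<and>
            card (transitions T) \<le> transition_bound (rules_size \<Delta>) \<and>
            \<Gamma> \<subseteq> states T \<and>
            (\<forall>b. \<forall>X \<in> \<Gamma>. \<forall>Y \<in> \<Gamma>.
               related b (vbpa_lts Act\<^sub>c Act\<^sub>r Act\<^sub>i \<Gamma> \<Delta>) [X] [Y] \<longleftrightarrow> related b T X Y)))"
\<comment> \<open>With at most \<open>k\<close> symbols and at most \<open>k\<close> rules, the time
  is at most \<open>800 * (2 * k + 1)\<close>.\<close>
proof (rule exI[of _ program], rule exI[of _ "\<lambda>k. 1600 * k + 800"], rule exI[of _ "\<lambda>k. 2 * k + 2"],
    rule exI[of _ "\<lambda>k. 4 * k + 2"], intro conjI allI impI linearly_bounded_affine)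
  fix Act\<^sub>c Act\<^sub>r Act\<^sub>i \<Gamma> :: "nat set" and \<Delta> w
  assume *: "vbpa Act\<^sub>c Act\<^sub>r Act\<^sub>i \<Gamma> \<Delta> \<and> all_symbols_used \<Gamma> \<Delta> \<and> encodes_vbpa w \<Gamma> \<Delta>"
  then obtain gs rs where gs: "enumerates gs \<Gamma>" and rs: "enumerates rs \<Delta>"
    and w: "w = encode_list (\<lambda>X. [X]) gs @ encode_list encode_rule rs"
    unfolding encodes_vbpa_def by blast
  from program_correct_vbpa[OF conjunct1[OF *] gs rs, of "[]"] obtain n m R v where
    run: "exec program (\<lambda>_. 0, w, []) n (m, [], v)" "n \<le> 800 * (length gs + length rs + 1)"
    and R: "represents R rs" "v = result_word gs rs (\<lambda>a. R a + 2) (insert (fresh gs) (normed \<Delta>))"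
    unfolding reaches_def w by fastforce
  obtain T where T: "encodes_lts v T" "finite_lts T" "card (states T) = length gs + length rs + 2"
    "card (transitions T) = 4 * length rs + 2" "\<Gamma> \<subseteq> states T"
    "\<forall>b. \<forall>X \<in> \<Gamma>. \<forall>Y \<in> \<Gamma>. related b (vbpa_lts Act\<^sub>c Act\<^sub>r Act\<^sub>i \<Gamma> \<Delta>) [X] [Y] \<longleftrightarrow> related b T X Y"
    using result_encodes_lts[OF conjunct1[OF *] gs rs R] by blast
  have len: "length rs \<le> rules_size \<Delta>" "length gs \<le> rules_size \<Delta>"
    using length_rules_le_size[OF rs] length_symbols_le_size[OF gs rs] * by auto
  have "outputs_in program w v n"
    using run(1) unfolding outputs_in_def by blast
  moreover have "n \<le> 1600 * rules_size \<Delta> + 800" "card (states T) \<le> 2 * rules_size \<Delta> + 2"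
    "card (transitions T) \<le> 4 * rules_size \<Delta> + 2"
    using run(2) T(3,4) len by simp_all
  ultimately show "\<exists>T v n. outputs_in program w v n \<and> n \<le> 1600 * rules_size \<Delta> + 800 \<and>
      encodes_lts v T \<and> finite_lts T \<and> card (states T) \<le> 2 * rules_size \<Delta> + 2 \<and>
      card (transitions T) \<le> 4 * rules_size \<Delta> + 2 \<and> \<Gamma> \<subseteq> states T \<and>
      (\<forall>b. \<forall>X \<in> \<Gamma>. \<forall>Y \<in> \<Gamma>.
         related b (vbpa_lts Act\<^sub>c Act\<^sub>r Act\<^sub>i \<Gamma> \<Delta>) [X] [Y] \<longleftrightarrow> related b T X Y)"
    using T by blast
qed

text \<open>Symbols keep their names as states of \<open>T\<close>, so the query is passed on
  verbatim.\<close>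

definition copy_query :: ram where
  "copy_query = block [Read rx, Print rx, Read rx, Print rx]"

theorem vbpa_problem_reducible: "linear_time_reducible (vbpa_problem b) (finite_state_problem b)"
  unfolding linear_time_reducible_def
proof (rule exI[of _ "Seq program copy_query"], rule exI[of _ "\<lambda>k. 800 * k + 5"],
    intro conjI ballI linearly_bounded_affine)
  let ?inst = "\<lambda>Act\<^sub>c Act\<^sub>r Act\<^sub>i \<Gamma> \<Delta> gs rs X Y u. vbpa Act\<^sub>c Act\<^sub>r Act\<^sub>i \<Gamma> \<Delta> \<and> enumerates gs \<Gamma> \<and>
    enumerates rs \<Delta> \<and> X \<in> \<Gamma> \<and> Y \<in> \<Gamma> \<and>
    u = encode_list (\<lambda>X. [X]) gs @ encode_list encode_rule rs @ [X, Y]"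
  fix u assume u: "u \<in> fst (vbpa_problem b) \<union> snd (vbpa_problem b)"
  have pos: "\<exists>Act\<^sub>c Act\<^sub>r Act\<^sub>i \<Gamma> \<Delta> gs rs X Y. ?inst Act\<^sub>c Act\<^sub>r Act\<^sub>i \<Gamma> \<Delta> gs rs X Y u \<and>
      related b (vbpa_lts Act\<^sub>c Act\<^sub>r Act\<^sub>i \<Gamma> \<Delta>) [X] [Y]" if "u \<in> fst (vbpa_problem b)"
    using that unfolding vbpa_problem_def encodes_vbpa_def fst_conv by fastforce
  have neg: "\<exists>Act\<^sub>c Act\<^sub>r Act\<^sub>i \<Gamma> \<Delta> gs rs X Y. ?inst Act\<^sub>c Act\<^sub>r Act\<^sub>i \<Gamma> \<Delta> gs rs X Y u \<and>
      \<not> related b (vbpa_lts Act\<^sub>c Act\<^sub>r Act\<^sub>i \<Gamma> \<Delta>) [X] [Y]" if "u \<in> snd (vbpa_problem b)"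
    using that unfolding vbpa_problem_def encodes_vbpa_def snd_conv by fastforce
  obtain Act\<^sub>c Act\<^sub>r Act\<^sub>i \<Gamma> \<Delta> gs rs X Y where inst: "?inst Act\<^sub>c Act\<^sub>r Act\<^sub>i \<Gamma> \<Delta> gs rs X Y u"
    using u pos neg by blast
  let ?Q = "\<lambda>(m :: nat \<Rightarrow> nat, u' :: nat list, v). \<exists>R. represents R rs \<and>
    v = result_word gs rs (\<lambda>a. R a + 2) (insert (fresh gs) (normed \<Delta>)) @ [X, Y]"
  have "reaches (Seq program copy_query) (\<lambda>_. 0, u, []) (800 * (length gs + length rs + 1) + 5) ?Q"
  proof (rule reaches_Seq)
    show "reaches program (\<lambda>_. 0, u, []) (800 * (length gs + length rs + 1))
      (\<lambda>(m, u', v). u' = [X, Y] \<and> (\<exists>R. represents R rs \<and>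
         v = result_word gs rs (\<lambda>a. R a + 2) (insert (fresh gs) (normed \<Delta>))))"
      using program_correct_vbpa[of Act\<^sub>c Act\<^sub>r Act\<^sub>i \<Gamma> \<Delta> gs rs "[X, Y]"] inst by simp
  next
    fix c :: ram_config
    assume "case c of (m, u', v) \<Rightarrow> u' = [X, Y] \<and> (\<exists>R. represents R rs \<and>
       v = result_word gs rs (\<lambda>a. R a + 2) (insert (fresh gs) (normed \<Delta>)))"
    then show "reaches copy_query c 5 ?Q"
      by (intro reaches_loop_free) (cases c; auto simp: copy_query_def)+
  qed
  then obtain n m u' v R where exec: "exec (Seq program copy_query) (\<lambda>_. 0, u, []) n (m, u', v @ [X, Y])"
    and n: "n \<le> 800 * (length gs + length rs + 1) + 5"
    and R: "represents R rs" "v = result_word gs rs (\<lambda>a. R a + 2) (insert (fresh gs) (normed \<Delta>))"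
    unfolding reaches_def by auto
  \<comment> \<open>The output was obtained from one reading of \<open>u\<close> but must be correct
    for every reading. Unique decoding fixes symbols, rules and query; the partition of the actions
    may still vary, and the output word does not depend on it.\<close>
  have transfer: "\<exists>T. finite_lts T \<and> encodes_lts v T \<and> X' \<in> states T \<and> Y' \<in> states T \<and> X' = X \<and> Y' = Y \<and>
      (related b T X' Y' \<longleftrightarrow> related b (vbpa_lts Act\<^sub>c' Act\<^sub>r' Act\<^sub>i' \<Gamma>' \<Delta>') [X'] [Y'])"
    if inst': "?inst Act\<^sub>c' Act\<^sub>r' Act\<^sub>i' \<Gamma>' \<Delta>' gs' rs' X' Y' u" for Act\<^sub>c' Act\<^sub>r' Act\<^sub>i' \<Gamma>' \<Delta>' gs' rs' X' Y'
  proof -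
    have eq: "gs = gs'" "rs = rs'" "X' = X" "Y' = Y"
      using encode_vbpa_cancel[of gs rs "[X, Y]" gs' rs' "[X', Y']"] inst inst' by auto
    then have \<Delta>: "\<Delta>' = \<Delta>"
      using inst inst' by (auto simp: enumerates_def)
    have "vbpa Act\<^sub>c' Act\<^sub>r' Act\<^sub>i' \<Gamma>' \<Delta>'" "enumerates gs \<Gamma>'" "enumerates rs \<Delta>'" "X' \<in> \<Gamma>'" "Y' \<in> \<Gamma>'"
      using inst' eq by auto
    with result_encodes_lts[OF this(1-3) R(1), of v] R(2) \<Delta> show ?thesis
      using eq by blast
  qed
  have len: "length gs + length rs + 4 \<le> length u"
    using length_encoded_vbpa[of gs rs] inst by simp
  have "outputs_in (Seq program copy_query) u (v @ [X, Y]) n"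
    using exec unfolding outputs_in_def by blast
  moreover have "n \<le> 800 * length u + 5"
    using n len by simp
  moreover have "v @ [X, Y] \<in> fst (finite_state_problem b)" if "u \<in> fst (vbpa_problem b)"
    using pos[OF that] transfer unfolding finite_state_problem_def fst_conv mem_Collect_eq by metis
  moreover have "v @ [X, Y] \<in> snd (finite_state_problem b)" if "u \<in> snd (vbpa_problem b)"
    using neg[OF that] transfer unfolding finite_state_problem_def snd_conv mem_Collect_eq by metis
  ultimately show "\<exists>v n. outputs_in (Seq program copy_query) u v n \<and> n \<le> 800 * length u + 5 \<and>
      (u \<in> fst (vbpa_problem b) \<longrightarrow> v \<in> fst (finite_state_problem b)) \<and>
      (u \<in> snd (vbpa_problem b) \<longrightarrow> v \<in> snd (finite_state_problem b))"
    by blast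
qed

theorem theorem3p6:
  "(\<exists>(p :: ram) time_bound state_bound transition_bound.
      linearly_bounded time_bound \<and> linearly_bounded state_bound \<and> linearly_bounded transition_bound \<and>
      (\<forall>(Act\<^sub>c :: nat set) Act\<^sub>r Act\<^sub>i (\<Gamma> :: nat set) \<Delta> w.
         vbpa Act\<^sub>c Act\<^sub>r Act\<^sub>i \<Gamma> \<Delta> \<and> all_symbols_used \<Gamma> \<Delta> \<and> encodes_vbpa w \<Gamma> \<Delta> \<longrightarrow>
         (\<exists>(T :: (nat, nat) lts) v n.
            outputs_in p w v n \<and> n \<le> time_bound (rules_size \<Delta>) \<and>
            encodes_lts v T \<and> finite_lts T \<and>
            card (states T) \<le> state_bound (rules_size \<Delta>) \<and>
            card (transitions T) \<le> transition_bound (rules_size \<Delta>) \<and>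
            \<Gamma> \<subseteq> states T \<and>
            (\<forall>b. \<forall>X \<in> \<Gamma>. \<forall>Y \<in> \<Gamma>.
               related b (vbpa_lts Act\<^sub>c Act\<^sub>r Act\<^sub>i \<Gamma> \<Delta>) [X] [Y] \<longleftrightarrow> related b T X Y)))) \<and>
   (\<forall>b. linear_time_reducible (vbpa_problem b) (finite_state_problem b))"
  using vbpa_translation vbpa_problem_reducible by blast

end
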